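(* Let $k\ge2$ be a fixed integer and let $(\alpha_l)_{l\ge0}$, $(\gamma_l)_{l\ge0}$ be real sequences with $\alpha_l>-1/2$, $\gamma_l>-1$, $\lim_{l\to\infty}\frac{\alpha_l}{l}=a\ge 0$ and $\lim_{l\to\infty}\frac{\gamma_l}{l}=c\ge0$. For $l\ge1$ put $\alpha_l^*=\alpha_{\lfloor (l-1)/k\rfloor}$, $\gamma_l^*=\gamma_{\lfloor (l-1)/k\rfloor}$, and for $y\in[-1,1]$ let $$M_l^{(\alpha_l^*,\gamma_l^* )}(y)=\#\{x\le y \mid B_l^{(\alpha_l^*,\gamma_l^* )}(x,k)=0\}$$ be the number of zeros less than or equal to $y$ of the generalized sieved ultraspherical polynomial of the second kind $B_l^{(\alpha_l^*,\gamma_l^* )}(x,k)$. Then for every $y\in[-1,1]$ $$\lim_{l\to\infty}\frac1l M_l^{(\alpha_l^*,\gamma_l^* )}(y)=\frac{2a+c+2}{2\pi}\int_{-1}^{y}\frac{\sqrt{4\mu_{a,c}-(T_k^2(x)-\kappa_{a,c})^2}}{|U_{k-1}(x)|\,|T_k(x)|\,(1-x^2)}\,I\{x\in\overline{E_k(\kappa_{a,c},\mu_{a,c})}\}\,dx,$$ where $$\mu_{a,c}=\frac{(2a+1)(c+1)(2a+c+1)}{(2a+c+2)^4},\qquad \kappa_{a,c}=\frac{(2a+1)(c+2)+c(c+1)}{(2a+c+2)^2}.$$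
   Context: $T_k$, $U_{k-1}$ are the Chebyshev polynomials of the first and second kind, $I$ denotes the indicator function, $\lfloor\cdot\rfloor$ the floor function, and $\overline{E_k(\kappa,\mu)}$ is the closure of $E_k(\kappa,\mu)=\{x\in[-1,1] : |T_k^2(x)-\kappa|^2<4\mu\}$. For $\alpha>-1/2$, $\gamma>-1$ the generalized sieved ultraspherical polynomials of the second kind $B_n^{(\alpha,\gamma)}(x,k)$ are the orthogonal polynomials on $[-1,1]$ with respect to $(1-x^2)^{\alpha+1/2}|U_{k-1}(x)|^{2\alpha}|T_k(x)|^{\gamma}dx$, defined by $B_0^{(\alpha,\gamma)}(x,k)=1$, $B_1^{(\alpha,\gamma)}(x,k)=2x$ and, writing $B_j=B_j^{(\alpha,\gamma)}(x,k)$, for $n,j\ge1$: $(2\alpha+\gamma+2n)xB_{nk-1}=nB_{nk}+(2\alpha+\gamma+n)B_{nk-2}$ if $n$ is even; $(2\alpha+\gamma+2n)xB_{nk-1}=(n+\gamma)B_{nk}+(n+2\alpha)B_{nk-2}$ if $n$ is odd; $2xB_j=B_{j+1}+B_{j-1}$ if $k\nmid j+1$. *)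

theory Defs
  imports "HOL-Analysis.Analysis" "HOL-Computational_Algebra.Polynomial"
begin

fun cheb_T :: "nat \<Rightarrow> real poly" where
  "cheb_T 0 = 1"
| "cheb_T (Suc 0) = [:0, 1:]"
| "cheb_T (Suc (Suc n)) = [:0, 2:] * cheb_T (Suc n) - cheb_T n"

fun cheb_U :: "nat \<Rightarrow> real poly" where
  "cheb_U 0 = 1"
| "cheb_U (Suc 0) = [:0, 2:]"
| "cheb_U (Suc (Suc n)) = [:0, 2:] * cheb_U (Suc n) - cheb_U n"

lemma cheb_T_cos: "poly (cheb_T n) (cos t) = cos (real n * t)"
proof (induction n rule: cheb_T.induct)
  case (3 n)
  have "cos (real (Suc (Suc n)) * t) + cos (real n * t) = 2 * cos t * cos (real (Suc n) * t)"
    using cos_add[of "real (Suc n) * t" t] cos_diff[of "real (Suc n) * t" t]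
    by (simp add: algebra_simps)
  then show ?case using 3 by simp
qed simp_all

lemma cheb_U_cos: "sin t * poly (cheb_U n) (cos t) = sin (real (n + 1) * t)"
proof (induction n rule: cheb_U.induct)
  case 2
  then show ?case by (simp add: sin_double)
next
  case (3 n)
  have *: "sin (real (Suc (Suc n) + 1) * t) + sin (real (n + 1) * t)
      = 2 * cos t * sin (real (Suc n + 1) * t)"
    using sin_add[of "real (Suc n + 1) * t" t] sin_diff[of "real (Suc n + 1) * t" t]
    by (simp add: algebra_simps)
  have "sin t * poly (cheb_U (Suc (Suc n))) (cos t)
      = 2 * cos t * (sin t * poly (cheb_U (Suc n)) (cos t)) - sin t * poly (cheb_U n) (cos t)"
    by (simp add: algebra_simps)
  then show ?case using 3 * by simp
qed simp

text \<open>
  The polynomials \<open>B\<^sub>m\<close> for parameters \<open>\<alpha>\<close>, \<open>\<gamma>\<close> and sieve parameter \<open>k\<close>. In the recursive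
  equation, \<open>m = j + 2\<close>; if \<open>k\<close> divides \<open>m\<close>, then \<open>m = n k\<close> and the three-term relation centred at
  index \<open>n k - 1\<close> is solved for its leading member. The leading coefficients \<open>n\<close> and \<open>n + \<gamma>\<close> are
  nonzero because \<open>n \<ge> 1\<close> and \<open>\<gamma> > -1\<close>. The relations in their original form are
  the lemmas below.
\<close>
fun sieved_B :: "real \<Rightarrow> real \<Rightarrow> nat \<Rightarrow> nat \<Rightarrow> real poly" where
  "sieved_B \<alpha> \<gamma> k 0 = 1"
| "sieved_B \<alpha> \<gamma> k (Suc 0) = [:0, 2:]"
| "sieved_B \<alpha> \<gamma> k (Suc (Suc j)) =
    (if k dvd Suc (Suc j) then
       (let n = Suc (Suc j) div k in
        if even n then
          smult (1 / real n)
            (smult (2 * \<alpha> + \<gamma> + 2 * real n) ([:0, 1:] * sieved_B \<alpha> \<gamma> k (Suc j))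
             - smult (2 * \<alpha> + \<gamma> + real n) (sieved_B \<alpha> \<gamma> k j))
        else
          smult (1 / (real n + \<gamma>))
            (smult (2 * \<alpha> + \<gamma> + 2 * real n) ([:0, 1:] * sieved_B \<alpha> \<gamma> k (Suc j))
             - smult (real n + 2 * \<alpha>) (sieved_B \<alpha> \<gamma> k j)))
     else [:0, 2:] * sieved_B \<alpha> \<gamma> k (Suc j) - sieved_B \<alpha> \<gamma> k j)"

lemma sieved_B_at_multiple:
  assumes k: "k \<ge> 2" and n: "n \<ge> 1" and g: "\<gamma> > -1"
  shows sieved_B_even: "even n \<Longrightarrow>
      smult (2 * \<alpha> + \<gamma> + 2 * real n) ([:0, 1:] * sieved_B \<alpha> \<gamma> k (n * k - 1))
      = smult (real n) (sieved_B \<alpha> \<gamma> k (n * k))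
        + smult (2 * \<alpha> + \<gamma> + real n) (sieved_B \<alpha> \<gamma> k (n * k - 2))"
    and sieved_B_odd: "odd n \<Longrightarrow>
      smult (2 * \<alpha> + \<gamma> + 2 * real n) ([:0, 1:] * sieved_B \<alpha> \<gamma> k (n * k - 1))
      = smult (real n + \<gamma>) (sieved_B \<alpha> \<gamma> k (n * k))
        + smult (real n + 2 * \<alpha>) (sieved_B \<alpha> \<gamma> k (n * k - 2))"
proof -
  have "1 * 2 \<le> n * k" using k n by (intro mult_le_mono) auto
  then obtain j where j: "n * k = Suc (Suc j)"
    by (metis add_2_eq_Suc le_add_diff_inverse mult_1)
  have d: "k dvd Suc (Suc j)" "Suc (Suc j) div k = n"
    using k by (simp_all flip: j)
  have nz: "real n \<noteq> 0" "real n + \<gamma> \<noteq> 0" using n g by auto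
  show "even n \<Longrightarrow>
      smult (2 * \<alpha> + \<gamma> + 2 * real n) ([:0, 1:] * sieved_B \<alpha> \<gamma> k (n * k - 1))
      = smult (real n) (sieved_B \<alpha> \<gamma> k (n * k))
        + smult (2 * \<alpha> + \<gamma> + real n) (sieved_B \<alpha> \<gamma> k (n * k - 2))"
    using nz by (simp add: j d Let_def)
  show "odd n \<Longrightarrow>
      smult (2 * \<alpha> + \<gamma> + 2 * real n) ([:0, 1:] * sieved_B \<alpha> \<gamma> k (n * k - 1))
      = smult (real n + \<gamma>) (sieved_B \<alpha> \<gamma> k (n * k))
        + smult (real n + 2 * \<alpha>) (sieved_B \<alpha> \<gamma> k (n * k - 2))"
    using nz by (simp add: j d Let_def)
qed

lemma sieved_B_not_multiple:
  assumes "j \<ge> 1" and "\<not> k dvd j + 1"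
  shows "[:0, 2:] * sieved_B \<alpha> \<gamma> k j = sieved_B \<alpha> \<gamma> k (j + 1) + sieved_B \<alpha> \<gamma> k (j - 1)"
  using assms by (cases j) auto

definition sieved_zero_count :: "real \<Rightarrow> real \<Rightarrow> nat \<Rightarrow> nat \<Rightarrow> real \<Rightarrow> nat" where
  "sieved_zero_count \<alpha> \<gamma> k l y = card {x. x \<le> y \<and> poly (sieved_B \<alpha> \<gamma> k l) x = 0}"

definition mu_lim :: "real \<Rightarrow> real \<Rightarrow> real" where
  "mu_lim a c = (2 * a + 1) * (c + 1) * (2 * a + c + 1) / (2 * a + c + 2) ^ 4"

definition kappa_lim :: "real \<Rightarrow> real \<Rightarrow> real" where
  "kappa_lim a c = ((2 * a + 1) * (c + 2) + c * (c + 1)) / (2 * a + c + 2)\<^sup>2"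

definition E_set :: "nat \<Rightarrow> real \<Rightarrow> real \<Rightarrow> real set" where
  "E_set k \<kappa> \<mu> = {x \<in> {-1..1}. \<bar>(poly (cheb_T k) x)\<^sup>2 - \<kappa>\<bar>\<^sup>2 < 4 * \<mu>}"

end

theory Submission
  imports Defs
begin

text \<open>
  With \<open>x = cos t\<close> one has \<open>B\<^bsub>nk-1\<^esub> = U\<^bsub>k-1\<^esub>(x) S\<^bsub>n-1\<^esub>(T\<^sub>k(x))\<close>, where the \<open>S\<^sub>n\<close> are generalized
  Gegenbauer polynomials. Ladder relations give their differential equation, and
  \<open>F(t) = \<bar>sin kt\<bar>\<^bsup>\<alpha>+1\<^esup> \<bar>cos kt\<bar>\<^bsup>\<gamma>/2\<^esup> S\<^sub>n(cos kt)\<close> solves \<open>F'' + Q F = 0\<close> with an explicit \<open>Q\<close>. Under the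
  hypotheses \<open>Q / l\<^sup>2\<close> converges locally uniformly to a function \<open>g\<close> away from the zeros of
  \<open>sin 2kt\<close>, so Sturm comparison with constant coefficients shows that zeros have local
  density \<open>l sqrt(max 0 g) / \<pi>\<close>, which is the stated density in the variable \<open>t\<close>. At the
  singular points \<open>Q\<close> may tend to infinity, and there comparison with
  \<open>sqrt \<bar>sin 2kt\<bar>\<close> times a cosine still gives a Lipschitz bound, so no zeros accumulate. The
  upper and lower limits of the normalized counts are therefore Lipschitz in \<open>t\<close> with the same derivative
  off a finite set, and hence equal to the integral of the density. General indices \<open>l\<close> are
  reduced to \<open>nk - 1\<close> with \<open>n\<close> even by interlacing.
\<close>

text \<open>The parameters vary with l, so every estimate must be uniform in \<alpha> and \<gamma>.
  Up to the factor k^2 the singular coefficients of Q are -\<alpha>(\<alpha>+1) and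
  -\<gamma>(\<gamma>+2)/4. On the whole parameter range neither exceeds 1/4, the critical
  inverse-square constant, and sqrt |sin 2kt| solves an equation with exactly this critical
  singularity. Hence \<alpha> close to -1/2 or \<gamma> close to -1 does no harm to the Lipschitz
  bound. The equation of S_n depends on the parity of n, so fixing odd n leaves a single formula for
  Q; the change of index moves the count by at most 3k, which disappears after division by l. The
  set E_k is the zone of oscillation: sin^2(kt) cos^2(kt) g(t) is a quadratic polynomial in T_k(x)^2
  = cos^2(kt) with roots kappa +- 2 sqrt(mu), and completing its square is the origin of the two
  constants.\<close>

section \<open>Sturm comparison and zero counting\<close>

lemma finite_consecutive:
  fixes s t :: real
  assumes "finite Z" "s \<in> Z" "t \<in> Z" "s < t"
  obtains t' where "t' \<in> Z" "s < t'" "t' \<le> t" "\<And>x. s < x \<Longrightarrow> x < t' \<Longrightarrow> x \<notin> Z"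
proof -
  let ?A = "Z \<inter> {s<..t}"
  have A: "finite ?A" "?A \<noteq> {}" using assms by auto
  have "Min ?A \<in> ?A" using A by (rule Min_in)
  moreover have "x \<notin> Z" if "s < x" "x < Min ?A" for x
  proof
    assume "x \<in> Z"
    with that \<open>Min ?A \<in> ?A\<close> have "x \<in> ?A" by auto
    with A(1) have "Min ?A \<le> x" by simp
    with that show False by simp
  qed
  ultimately show ?thesis using that by auto
qed

lemma nonzero_constant_sign:
  fixes F :: "real \<Rightarrow> real"
  assumes "is_interval I" "continuous_on I F" "\<And>x. x \<in> I \<Longrightarrow> F x \<noteq> 0"
  shows "(\<forall>x\<in>I. F x > 0) \<or> (\<forall>x\<in>I. F x < 0)"
proof (rule ccontr)
  assume "\<not> ?thesis"
  then obtain x y where xy: "x \<in> I" "y \<in> I" "F x < 0" "F y > 0"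
    using assms(3) by (meson linorder_neqE_linordered_idom)
  have "is_interval (F ` I)"
    using assms by (simp add: is_interval_connected_1 connected_continuous_image)
  hence "0 \<in> F ` I"
    using xy by (intro mem_is_interval_1_I[of "F ` I" "F x" "F y" 0]) auto
  thus False using assms(3) by auto
qed

text \<open>The Wronskian is monotone and vanishes where \<open>F / G\<close> has a critical point, so
  \<open>F / G\<close> first decreases and then increases; being zero at both ends, it is nonpositive.\<close>

lemma supersolution_nonpos:
  fixes F F1 G G1 G2 Q :: "real \<Rightarrow> real"
  assumes st: "s < t"
    and F: "\<And>x. x \<in> {s..t} \<Longrightarrow> (F has_real_derivative F1 x) (at x)"
           "\<And>x. x \<in> {s..t} \<Longrightarrow> (F1 has_real_derivative - Q x * F x) (at x)"
    and G: "\<And>x. x \<in> {s..t} \<Longrightarrow> (G has_real_derivative G1 x) (at x)"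
           "\<And>x. x \<in> {s..t} \<Longrightarrow> (G1 has_real_derivative G2 x) (at x)"
    and Gpos: "\<And>x. x \<in> {s..t} \<Longrightarrow> G x > 0"
    and super: "\<And>x. x \<in> {s..t} \<Longrightarrow> G2 x + Q x * G x \<le> 0"
    and zero: "F s = 0" "F t = 0"
    and nonneg: "\<And>x. x \<in> {s..t} \<Longrightarrow> F x \<ge> 0"
    and x: "x \<in> {s..t}"
  shows "F x \<le> 0"
proof -
  define W where "W x = F1 x * G x - F x * G1 x" for x
  define R where "R x = F x / G x" for x
  have dW: "(W has_real_derivative - F x * (G2 x + Q x * G x)) (at x)" if "x \<in> {s..t}" for x
    unfolding W_def using that
    by (auto intro!: derivative_eq_intros F G simp: algebra_simps)
  have dR: "(R has_real_derivative W x / (G x)\<^sup>2) (at x)" if "x \<in> {s..t}" for x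
    unfolding W_def R_def using that Gpos[OF that]
    by (auto intro!: derivative_eq_intros F G simp: power2_eq_square)
  have Wmono: "W u \<le> W v" if "s \<le> u" "u \<le> v" "v \<le> t" for u v
  proof (rule DERIV_nonneg_imp_nondecreasing[of u v W, OF that(2)])
    fix x assume x: "u \<le> x" "x \<le> v"
    hence "x \<in> {s..t}" using that by auto
    moreover have "- F x * (G2 x + Q x * G x) \<ge> 0"
      using nonneg[OF \<open>x \<in> {s..t}\<close>] super[OF \<open>x \<in> {s..t}\<close>] by (simp add: mult_nonneg_nonpos)
    ultimately show "\<exists>y. (W has_real_derivative y) (at x) \<and> 0 \<le> y" using dW by blast
  qed
  obtain z where z: "s < z" "z < t" "W z / (G z)\<^sup>2 = 0"
  proof -
    obtain z where z: "s < z" "z < t" "R t - R s = (t - s) * (W z / (G z)\<^sup>2)"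
      using MVT2[OF st, of R "\<lambda>x. W x / (G x)\<^sup>2"] dR by auto
    with st zero have "W z / (G z)\<^sup>2 = 0" by (simp add: R_def)
    with z that show ?thesis by blast
  qed
  have Wz: "W z = 0" using z Gpos[of z] by auto
  have "R x \<le> 0"
  proof (cases "x \<le> z")
    case True
    have "R x \<le> R s"
    proof (rule DERIV_nonpos_imp_nonincreasing[of s x R])
      show "s \<le> x" using x by auto
      fix y assume y: "s \<le> y" "y \<le> x"
      hence "W y \<le> 0" using Wmono[of y z] Wz True z by auto
      thus "\<exists>d. (R has_real_derivative d) (at y) \<and> d \<le> 0"
        using dR[of y] y True z by (intro exI[of _ "W y / (G y)\<^sup>2"]) (auto simp: divide_nonpos_nonneg)
    qed
    thus ?thesis using zero by (simp add: R_def)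
  next
    case False
    have "R x \<le> R t"
    proof (rule DERIV_nonneg_imp_nondecreasing[of x t R])
      show "x \<le> t" using x by auto
      fix y assume y: "x \<le> y" "y \<le> t"
      hence "W y \<ge> 0" using Wmono[of z y] Wz False z by auto
      thus "\<exists>d. (R has_real_derivative d) (at y) \<and> 0 \<le> d"
        using dR[of y] y False z by (intro exI[of _ "W y / (G y)\<^sup>2"]) auto
    qed
    thus ?thesis using zero by (simp add: R_def)
  qed
  thus ?thesis using Gpos[OF x] by (simp add: R_def divide_le_0_iff)
qed

text \<open>Between consecutive zeros F has one sign, and -F solves the same equation, so
  \<open>supersolution_nonpos\<close> applies to F or to -F. Finiteness of the zero set provides the
  consecutive zeros and rules out F = 0.\<close>

lemma supersolution_no_two_zeros:
  fixes F F1 G G1 G2 Q :: "real \<Rightarrow> real"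
  assumes st: "s < t"
    and F: "\<And>x. x \<in> {s..t} \<Longrightarrow> (F has_real_derivative F1 x) (at x)"
           "\<And>x. x \<in> {s..t} \<Longrightarrow> (F1 has_real_derivative - Q x * F x) (at x)"
    and G: "\<And>x. x \<in> {s..t} \<Longrightarrow> (G has_real_derivative G1 x) (at x)"
           "\<And>x. x \<in> {s..t} \<Longrightarrow> (G1 has_real_derivative G2 x) (at x)"
    and Gpos: "\<And>x. x \<in> {s..t} \<Longrightarrow> G x > 0"
    and super: "\<And>x. x \<in> {s..t} \<Longrightarrow> G2 x + Q x * G x \<le> 0"
    and zero: "F s = 0" "F t = 0"
    and fin: "finite {x \<in> {s..t}. F x = 0}"
  shows False
proof -
  obtain t' where t': "F t' = 0" "s < t'" "t' \<le> t" and
    nz: "\<And>x. s < x \<Longrightarrow> x < t' \<Longrightarrow> F x \<noteq> 0"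
    using finite_consecutive[OF fin, of s t] st zero by auto
  have sub: "x \<in> {s..t}" if "x \<in> {s..t'}" for x using that t' by auto
  define m where "m = (s + t') / 2"
  have m: "s < m" "m < t'" using t' by (auto simp: m_def)
  have cont: "continuous_on {s<..<t'} F"
    using DERIV_isCont[OF F(1)] t' by (intro continuous_at_imp_continuous_on) auto
  have "(\<forall>x\<in>{s<..<t'}. F x > 0) \<or> (\<forall>x\<in>{s<..<t'}. F x < 0)"
    using cont nz by (intro nonzero_constant_sign) (auto simp: is_interval_1)
  thus False
  proof
    assume pos: "\<forall>x\<in>{s<..<t'}. F x > 0"
    have "F m \<le> 0"
    proof (rule supersolution_nonpos[OF t'(2), of F F1 Q G G1 G2])
      show "F x \<ge> 0" if "x \<in> {s..t'}" for x
        using pos that zero t' by (cases "x = s \<or> x = t'") (auto simp: less_imp_le)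
    qed (use F G Gpos super zero t' m sub in auto)
    with pos m show False by force
  next
    assume neg: "\<forall>x\<in>{s<..<t'}. F x < 0"
    have "- F m \<le> 0"
    proof (rule supersolution_nonpos[OF t'(2), of "\<lambda>x. - F x" "\<lambda>x. - F1 x" Q G G1 G2])
      show "- F x \<ge> 0" if "x \<in> {s..t'}" for x
        using neg that zero t' by (cases "x = s \<or> x = t'") (auto simp: less_imp_le)
      show "((\<lambda>x. - F x) has_real_derivative - F1 x) (at x)" if "x \<in> {s..t'}" for x
        using F(1)[OF sub[OF that]] by (rule DERIV_minus)
      show "((\<lambda>x. - F1 x) has_real_derivative - Q x * - F x) (at x)" if "x \<in> {s..t'}" for x
        using DERIV_minus[OF F(2)[OF sub[OF that]]] by simp
    qed (use G Gpos super zero t' m sub in auto)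
    with neg m show False by force
  qed
qed

text \<open>Comparison with sin(\<omega>(x - s)), which is positive up to s + pi/\<omega>. If F kept
  a sign, say F > 0, the Wronskian \<open>W\<close> would be nonincreasing, although it is negative
  at s and nonnegative at the right end. The window is half-open so that windows can be laid side by
  side without sharing a zero.\<close>

lemma sturm_zero_exists:
  fixes F F1 Q :: "real \<Rightarrow> real"
  assumes w: "\<omega> > 0"
    and F: "\<And>x. x \<in> {s..s + pi / \<omega>} \<Longrightarrow> (F has_real_derivative F1 x) (at x)"
           "\<And>x. x \<in> {s..s + pi / \<omega>} \<Longrightarrow> (F1 has_real_derivative - Q x * F x) (at x)"
    and Q: "\<And>x. x \<in> {s..s + pi / \<omega>} \<Longrightarrow> Q x \<ge> \<omega>\<^sup>2"
  shows "\<exists>x\<in>{s..<s + pi / \<omega>}. F x = 0"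
proof (rule ccontr)
  assume no: "\<not> ?thesis"
  define t where "t = s + pi / \<omega>"
  have st: "s < t" using w by (simp add: t_def)
  have wst: "\<omega> * (t - s) = pi" using w by (simp add: t_def)
  have contF: "continuous_on {s..t} F"
    using DERIV_isCont[OF F(1)] unfolding t_def by (intro continuous_at_imp_continuous_on) auto
  have core: False
    if H: "\<And>x. x \<in> {s..t} \<Longrightarrow> (H has_real_derivative H1 x) (at x)"
          "\<And>x. x \<in> {s..t} \<Longrightarrow> (H1 has_real_derivative - Q x * H x) (at x)"
      and pos: "\<And>x. x \<in> {s..<t} \<Longrightarrow> H x > 0" and cH: "continuous_on {s..t} H" for H H1
  proof -
    have Ht: "H t \<ge> 0"
    proof (rule ccontr)
      assume "\<not> ?thesis"
      hence "\<exists>x. s \<le> x \<and> x \<le> t \<and> H x = 0"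
        using IVT2'[of H t 0 s] pos[of s] st cH by auto
      then obtain x where "s \<le> x" "x \<le> t" "H x = 0" by blast
      with pos[of x] \<open>\<not> H t \<ge> 0\<close> show False by (cases "x = t") auto
    qed
    define W where "W x = H1 x * sin (\<omega> * (x - s)) - H x * (\<omega> * cos (\<omega> * (x - s)))" for x
    have "W t \<le> W s"
    proof (rule DERIV_nonpos_imp_nonincreasing[of s t W])
      show "s \<le> t" using st by simp
      fix x assume x: "s \<le> x" "x \<le> t"
      have "(W has_real_derivative - (H x * sin (\<omega> * (x - s)) * (Q x - \<omega>\<^sup>2))) (at x)"
        unfolding W_def using x
        by (auto intro!: derivative_eq_intros H simp: algebra_simps power2_eq_square)
      moreover have "sin (\<omega> * (x - s)) \<ge> 0"
      proof (rule sin_ge_zero)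
        show "0 \<le> \<omega> * (x - s)" using x w by simp
        have "\<omega> * (x - s) \<le> \<omega> * (t - s)" using x w by simp
        thus "\<omega> * (x - s) \<le> pi" using wst by simp
      qed
      moreover have "H x \<ge> 0" using pos[of x] Ht x by (cases "x = t") auto
      moreover have "Q x \<ge> \<omega>\<^sup>2" using Q x by (simp add: t_def)
      ultimately show "\<exists>d. (W has_real_derivative d) (at x) \<and> d \<le> 0"
        by (intro exI[of _ "- (H x * sin (\<omega> * (x - s)) * (Q x - \<omega>\<^sup>2))"]) simp
    qed
    moreover have "W s < 0" using pos[of s] st w by (simp add: W_def)
    moreover have "W t \<ge> 0" using Ht w wst by (simp add: W_def)
    ultimately show False by simp
  qed
  have "(\<forall>x\<in>{s..<t}. F x > 0) \<or> (\<forall>x\<in>{s..<t}. F x < 0)"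
  proof (rule nonzero_constant_sign)
    show "continuous_on {s..<t} F" by (rule continuous_on_subset[OF contF]) auto
  qed (use no in \<open>auto simp: is_interval_1 t_def\<close>)
  thus False
  proof
    assume "\<forall>x\<in>{s..<t}. F x > 0"
    thus False using F contF by (intro core[of F F1]) (auto simp: t_def)
  next
    assume *: "\<forall>x\<in>{s..<t}. F x < 0"
    show False
    proof (rule core[of "\<lambda>x. - F x" "\<lambda>x. - F1 x"])
      show "((\<lambda>x. - F x) has_real_derivative - F1 x) (at x)" if "x \<in> {s..t}" for x
        using F(1) that by (auto intro!: DERIV_minus simp: t_def)
      show "((\<lambda>x. - F1 x) has_real_derivative - Q x * - F x) (at x)" if "x \<in> {s..t}" for x
        using DERIV_minus[OF F(2)] that by (auto simp: t_def)
    qed (use * contF in \<open>auto intro!: continuous_intros\<close>)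
  qed
qed

text \<open>Cut [u, v) into cells of length \<delta>: each cell holds at most one point, and the
  extra 1 is the incomplete last cell.\<close>

lemma card_separated_le:
  fixes A :: "real set"
  assumes "A \<subseteq> {u..<v}" "u \<le> v" "\<delta> > 0"
    and sep: "\<And>x y. x \<in> A \<Longrightarrow> y \<in> A \<Longrightarrow> x < y \<Longrightarrow> y - x \<ge> \<delta>"
  shows "finite A" "real (card A) \<le> (v - u) / \<delta> + 1"
proof -
  define \<phi> where "\<phi> x = \<lfloor>(x - u) / \<delta>\<rfloor>" for x
  have lt: "\<phi> x < \<phi> y" if "x \<in> A" "y \<in> A" "x < y" for x y
  proof -
    have "(x - u) / \<delta> + 1 \<le> (y - u) / \<delta>"
      using divide_right_mono[OF sep[OF that], of \<delta>] assms(3) by (simp add: diff_divide_distrib)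
    thus ?thesis unfolding \<phi>_def by linarith
  qed
  have inj: "inj_on \<phi> A"
    by (rule inj_onI) (metis lt less_irrefl linorder_neqE_linordered_idom)
  have sub: "\<phi> ` A \<subseteq> {0..\<lfloor>(v - u) / \<delta>\<rfloor>}"
    using assms by (auto simp: \<phi>_def divide_right_mono floor_mono intro!: divide_nonneg_pos)
  show fin: "finite A" using finite_subset[OF sub] inj finite_imageD by blast
  have "card A \<le> card {0..\<lfloor>(v - u) / \<delta>\<rfloor>}"
    using card_mono[OF _ sub] card_image[OF inj] by simp
  hence "real (card A) \<le> real (nat (\<lfloor>(v - u) / \<delta>\<rfloor> + 1))" by simp
  also have "\<dots> = of_int (\<lfloor>(v - u) / \<delta>\<rfloor> + 1)"
  proof -
    have "0 \<le> (v - u) / \<delta>" using assms by simp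
    hence "0 \<le> \<lfloor>(v - u) / \<delta>\<rfloor>" by simp
    thus ?thesis by simp
  qed
  also have "\<dots> \<le> (v - u) / \<delta> + 1" by simp
  finally show "real (card A) \<le> (v - u) / \<delta> + 1" .
qed

text \<open>One point is chosen from each complete cell of length \<delta>; the loss of 1 is again
  the incomplete last cell.\<close>

lemma card_dense_ge:
  fixes A :: "real set"
  assumes "finite A" "\<delta> > 0"
    and dense: "\<And>s. u \<le> s \<Longrightarrow> s + \<delta> \<le> v \<Longrightarrow> \<exists>x\<in>A. s \<le> x \<and> x < s + \<delta>"
  shows "real (card A) \<ge> (v - u) / \<delta> - 1"
proof (cases "u \<le> v")
  case False
  hence "(v - u) / \<delta> \<le> 0" using assms(2) by (simp add: divide_nonpos_pos)
  thus ?thesis by (smt (verit) of_nat_0_le_iff)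
next
  case True
  define n where "n = nat \<lfloor>(v - u) / \<delta>\<rfloor>"
  have n: "real n \<le> (v - u) / \<delta>" "(v - u) / \<delta> - 1 \<le> real n"
    using True assms(2) by (auto simp: n_def)
  have "\<exists>x\<in>A. u + real i * \<delta> \<le> x \<and> x < u + real i * \<delta> + \<delta>" if "i < n" for i
  proof (rule dense)
    show "u \<le> u + real i * \<delta>" using assms(2) by simp
    have "real (i + 1) * \<delta> \<le> real n * \<delta>" using that assms(2) by (intro mult_right_mono) auto
    also have "\<dots> \<le> v - u" using n(1) assms(2) by (simp add: field_simps)
    finally show "u + real i * \<delta> + \<delta> \<le> v" by (simp add: algebra_simps)
  qed
  then obtain X where X: "\<And>i. i < n \<Longrightarrow> X i \<in> A \<and> u + real i * \<delta> \<le> X i \<and> X i < u + real i * \<delta> + \<delta>"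
    by metis
  have "X i < X j" if "i < j" "j < n" for i j
  proof -
    have "X i < u + real i * \<delta> + \<delta>" using X that by auto
    also have "\<dots> = u + real (i + 1) * \<delta>" by (simp add: algebra_simps)
    also have "\<dots> \<le> u + real j * \<delta>" using that assms(2) by (intro add_left_mono mult_right_mono) auto
    also have "\<dots> \<le> X j" using X that by auto
    finally show ?thesis .
  qed
  hence "inj_on X {..<n}"
    by (intro linorder_inj_onI) (auto, metis less_irrefl)
  hence "n = card (X ` {..<n})" by (simp add: card_image)
  also have "\<dots> \<le> card A" using X assms(1) by (intro card_mono) auto
  finally show ?thesis using n by simp
qed

text \<open>The number of points of B below x is strictly increasing for x in A and takes values in
  0, ..., card B.\<close>

lemma card_interlacing_le:
  fixes A B :: "real set"
  assumes "finite A" "finite B"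
    and sep: "\<And>x y. x \<in> A \<Longrightarrow> y \<in> A \<Longrightarrow> x < y \<Longrightarrow> \<exists>z\<in>B. x < z \<and> z < y"
  shows "card A \<le> card B + 1"
proof -
  define \<phi> where "\<phi> x = card {z \<in> B. z < x}" for x
  have "\<phi> x < \<phi> y" if xy: "x \<in> A" "y \<in> A" "x < y" for x y
    unfolding \<phi>_def
  proof (rule psubset_card_mono)
    obtain z where z: "z \<in> B" "x < z" "z < y" using sep[OF xy] by auto
    have "{z \<in> B. z < x} \<subseteq> {z \<in> B. z < y}" using xy(3) by (auto intro: less_trans)
    moreover have "z \<in> {z \<in> B. z < y}" "z \<notin> {z \<in> B. z < x}" using z by auto
    ultimately show "{z \<in> B. z < x} \<subset> {z \<in> B. z < y}" by blast
  qed (use assms in auto)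
  hence inj: "inj_on \<phi> A"
    by (intro inj_onI) (metis less_irrefl linorder_neqE_linordered_idom)
  have "\<phi> ` A \<subseteq> {0..card B}" using assms(2) by (auto simp: \<phi>_def intro!: card_mono)
  hence "card A \<le> card {0..card B}" using card_image[OF inj] card_mono by (metis finite_atLeastAtMost)
  thus ?thesis by simp
qed

text \<open>Rolle for f / g, whose derivative has the sign of the Wronskian. At x and y themselves g
  cannot vanish, because f does and the Wronskian is positive.\<close>

lemma wronskian_pos_zero_between:
  fixes f g :: "real poly"
  assumes W: "\<And>x. poly (pderiv f) x * poly g x - poly f x * poly (pderiv g) x > 0"
    and "x < y" "poly f x = 0" "poly f y = 0"
  shows "\<exists>z. x < z \<and> z < y \<and> poly g z = 0"
proof (rule ccontr)
  assume no: "\<not> ?thesis"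
  have nz: "poly g z \<noteq> 0" if "x \<le> z" "z \<le> y" for z
    using no that W[of x] W[of y] assms by (cases "z = x \<or> z = y") (auto simp: order_less_le)
  define R where "R x = poly f x / poly g x" for x
  have "\<exists>z. x < z \<and> z < y \<and> R y - R x = (y - x) *
     ((poly (pderiv f) z * poly g z - poly f z * poly (pderiv g) z) / (poly g z)\<^sup>2)"
  proof (rule MVT2[OF \<open>x < y\<close>])
    fix z assume "x \<le> z" "z \<le> y"
    thus "(R has_real_derivative (poly (pderiv f) z * poly g z - poly f z * poly (pderiv g) z)
            / (poly g z)\<^sup>2) (at z)"
      unfolding R_def using nz[of z]
      by (auto intro!: derivative_eq_intros simp: power2_eq_square)
  qed
  then obtain z where z: "x < z" "z < y" "0 = (y - x) *
     ((poly (pderiv f) z * poly g z - poly f z * poly (pderiv g) z) / (poly g z)\<^sup>2)"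
    using assms by (auto simp: R_def)
  thus False using W[of z] nz[of z] \<open>x < y\<close> by simp
qed

lemma wronskian_pos_card_le:
  fixes f g :: "real poly"
  assumes W: "\<And>x. poly (pderiv f) x * poly g x - poly f x * poly (pderiv g) x > 0"
    and "f \<noteq> 0" "g \<noteq> 0"
  shows "card {x. x \<le> y \<and> poly f x = 0} \<le> card {x. x \<le> y \<and> poly g x = 0} + 1"
    and "card {x. x \<le> y \<and> poly g x = 0} \<le> card {x. x \<le> y \<and> poly f x = 0} + 1"
proof -
  have fin: "finite {x. x \<le> y \<and> poly f x = 0}" "finite {x. x \<le> y \<and> poly g x = 0}"
    using poly_roots_finite[OF \<open>f \<noteq> 0\<close>] poly_roots_finite[OF \<open>g \<noteq> 0\<close>]
    by (auto elim: rev_finite_subset)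
  show "card {x. x \<le> y \<and> poly f x = 0} \<le> card {x. x \<le> y \<and> poly g x = 0} + 1"
  proof (rule card_interlacing_le[OF fin], goal_cases)
    case (1 u v)
    thus ?case using wronskian_pos_zero_between[OF W, of u v] by fastforce
  qed
  \<comment> \<open>Passing from (f, g) to (g, -f) preserves the Wronskian, so interlacing holds in
    both directions.\<close>
  have W': "poly (pderiv g) x * poly (- f) x - poly g x * poly (pderiv (- f)) x > 0" for x
    using W[of x] by (simp add: pderiv_minus algebra_simps)
  show "card {x. x \<le> y \<and> poly g x = 0} \<le> card {x. x \<le> y \<and> poly f x = 0} + 1"
  proof (rule card_interlacing_le[OF fin(2,1)], goal_cases)
    case (1 u v)
    thus ?case using wronskian_pos_zero_between[OF W', of u v] by fastforce
  qed
qed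

section \<open>The sieved polynomials and generalized Gegenbauer polynomials\<close>

text \<open>All cases of the recurrence, sieved or not, take one shape with positive p and r, and
  the middle coefficient is exactly p + r. Positivity gives the interlacing of zeros, the sum p + r
  the location of the zeros in (-1, 1).\<close>

lemma sieved_B_step:
  assumes "k \<ge> 2" "\<alpha> > -1/2" "\<gamma> > -1"
  obtains p r where "p > 0" "r > 0"
    "smult p (sieved_B \<alpha> \<gamma> k (Suc (Suc j)))
       = smult (p + r) ([:0, 1:] * sieved_B \<alpha> \<gamma> k (Suc j)) - smult r (sieved_B \<alpha> \<gamma> k j)"
proof (cases "k dvd Suc (Suc j)")
  case False
  show ?thesis
    by (rule that[of 1 1]) (use False in simp_all)
next
  case True
  then obtain n where n: "Suc (Suc j) = n * k" by (metis dvd_div_mult_self)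
  have n1: "n \<ge> 1" using n by (cases n) auto
  have j: "n * k - 1 = Suc j" "n * k - 2 = j" using n by auto
  show ?thesis
  proof (cases "even n")
    case True
    \<comment> \<open>Evenness matters here: 2\<alpha> + \<gamma> is only known to exceed -2, so the
      trailing coefficient would not be positive for n = 1.\<close>
    hence "n \<ge> 2" using n1 by (cases "n = 1") auto
    hence "2 * \<alpha> + \<gamma> + real n > 0" using assms by linarith
    with sieved_B_even[OF assms(1) n1 assms(3) True, of \<alpha>] \<open>n \<ge> 2\<close> show ?thesis
      by (intro that[of "real n" "2 * \<alpha> + \<gamma> + real n"])
         (simp_all only: j flip: n, simp_all add: algebra_simps)
  next
    case False
    with sieved_B_odd[OF assms(1) n1 assms(3) False, of \<alpha>] assms n1 show ?thesis
      by (intro that[of "real n + \<gamma>" "real n + 2 * \<alpha>"])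
         (simp_all only: j flip: n, simp_all add: algebra_simps)
  qed
qed

lemma sieved_B_step_poly:
  assumes "k \<ge> 2" "\<alpha> > -1/2" "\<gamma> > -1"
  obtains p r where "p > 0" "r > 0"
    "\<And>x. p * poly (sieved_B \<alpha> \<gamma> k (Suc (Suc j))) x
       = (p + r) * x * poly (sieved_B \<alpha> \<gamma> k (Suc j)) x - r * poly (sieved_B \<alpha> \<gamma> k j) x"
    "\<And>x. p * poly (pderiv (sieved_B \<alpha> \<gamma> k (Suc (Suc j)))) x
       = (p + r) * (poly (sieved_B \<alpha> \<gamma> k (Suc j)) x + x * poly (pderiv (sieved_B \<alpha> \<gamma> k (Suc j))) x)
           - r * poly (pderiv (sieved_B \<alpha> \<gamma> k j)) x"
proof -
  obtain p r where pr: "p > 0" "r > 0" and eq: "smult p (sieved_B \<alpha> \<gamma> k (Suc (Suc j)))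
       = smult (p + r) ([:0, 1:] * sieved_B \<alpha> \<gamma> k (Suc j)) - smult r (sieved_B \<alpha> \<gamma> k j)"
    using sieved_B_step[OF assms] by blast
  show ?thesis
  proof (rule that[OF pr])
    fix x
    show "p * poly (sieved_B \<alpha> \<gamma> k (Suc (Suc j))) x
       = (p + r) * x * poly (sieved_B \<alpha> \<gamma> k (Suc j)) x - r * poly (sieved_B \<alpha> \<gamma> k j) x"
      using arg_cong[OF eq, of "\<lambda>q. poly q x"]
      by (simp del: sieved_B.simps add: algebra_simps)
    show "p * poly (pderiv (sieved_B \<alpha> \<gamma> k (Suc (Suc j)))) x
       = (p + r) * (poly (sieved_B \<alpha> \<gamma> k (Suc j)) x + x * poly (pderiv (sieved_B \<alpha> \<gamma> k (Suc j))) x)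
           - r * poly (pderiv (sieved_B \<alpha> \<gamma> k j)) x"
      using arg_cong[OF eq, of "\<lambda>q. poly (pderiv q) x"]
      by (simp del: sieved_B.simps add: pderiv_smult pderiv_diff pderiv_mult pderiv_pCons algebra_simps)
  qed
qed

text \<open>Confluent Christoffel-Darboux argument: the recurrence gives p W_{j+1} = (p + r)
  B_{j+1}^2 + r W_j, and W_0 = 2.\<close>

lemma sieved_B_wronskian_pos:
  assumes "k \<ge> 2" "\<alpha> > -1/2" "\<gamma> > -1"
  shows "poly (pderiv (sieved_B \<alpha> \<gamma> k (Suc j))) x * poly (sieved_B \<alpha> \<gamma> k j) x
     - poly (sieved_B \<alpha> \<gamma> k (Suc j)) x * poly (pderiv (sieved_B \<alpha> \<gamma> k j)) x > 0"
proof (induction j)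
  case 0
  show ?case by (simp add: pderiv_pCons)
next
  case (Suc j)
  obtain p r where pr: "p > 0" "r > 0"
    and e: "p * poly (sieved_B \<alpha> \<gamma> k (Suc (Suc j))) x
       = (p + r) * x * poly (sieved_B \<alpha> \<gamma> k (Suc j)) x - r * poly (sieved_B \<alpha> \<gamma> k j) x"
    "p * poly (pderiv (sieved_B \<alpha> \<gamma> k (Suc (Suc j)))) x
       = (p + r) * (poly (sieved_B \<alpha> \<gamma> k (Suc j)) x + x * poly (pderiv (sieved_B \<alpha> \<gamma> k (Suc j))) x)
           - r * poly (pderiv (sieved_B \<alpha> \<gamma> k j)) x"
    using sieved_B_step_poly[OF assms] by metis
  define b2 b1 b0 d2 d1 d0 where
    "b2 = poly (sieved_B \<alpha> \<gamma> k (Suc (Suc j))) x" "b1 = poly (sieved_B \<alpha> \<gamma> k (Suc j)) x"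
    "b0 = poly (sieved_B \<alpha> \<gamma> k j) x" "d2 = poly (pderiv (sieved_B \<alpha> \<gamma> k (Suc (Suc j)))) x"
    "d1 = poly (pderiv (sieved_B \<alpha> \<gamma> k (Suc j))) x" "d0 = poly (pderiv (sieved_B \<alpha> \<gamma> k j)) x"
  note d = this
  have "p * (d2 * b1 - b2 * d1) = (p * d2) * b1 - (p * b2) * d1" by (simp add: algebra_simps)
  also have "\<dots> = (p + r) * b1\<^sup>2 + r * (d1 * b0 - b1 * d0)"
    unfolding e[folded d] by (simp add: algebra_simps power2_eq_square)
  also have "\<dots> > 0"
    using Suc.IH[folded d] pr by (intro add_nonneg_pos mult_nonneg_nonneg mult_pos_pos) auto
  finally have "d2 * b1 - b2 * d1 > 0" using pr by (simp add: zero_less_mult_iff)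
  thus ?case unfolding d .
qed

text \<open>The recurrence forces \<open>\<bar>B\<^sub>j\<bar>\<close> to grow outside \<open>(-1, 1)\<close> because its coefficients \<open>p + r\<close>
  and \<open>r\<close> balance exactly at \<open>\<bar>x\<bar> = 1\<close>.\<close>

lemma sieved_B_abs_ge_1:
  assumes "k \<ge> 2" "\<alpha> > -1/2" "\<gamma> > -1" "\<bar>x\<bar> \<ge> 1"
  shows "\<bar>poly (sieved_B \<alpha> \<gamma> k j) x\<bar> \<ge> 1"
proof -
  have "1 \<le> \<bar>poly (sieved_B \<alpha> \<gamma> k j) x\<bar> \<and>
      \<bar>poly (sieved_B \<alpha> \<gamma> k j) x\<bar> \<le> \<bar>poly (sieved_B \<alpha> \<gamma> k (Suc j)) x\<bar>"
  proof (induction j)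
    case 0
    show ?case using assms(4) by simp
  next
    case (Suc j)
    obtain p r where pr: "p > 0" "r > 0"
      and e: "p * poly (sieved_B \<alpha> \<gamma> k (Suc (Suc j))) x
       = (p + r) * x * poly (sieved_B \<alpha> \<gamma> k (Suc j)) x - r * poly (sieved_B \<alpha> \<gamma> k j) x"
      using sieved_B_step_poly[OF assms(1-3)] by metis
    define b2 b1 b0 where "b2 = poly (sieved_B \<alpha> \<gamma> k (Suc (Suc j))) x"
      "b1 = poly (sieved_B \<alpha> \<gamma> k (Suc j)) x" "b0 = poly (sieved_B \<alpha> \<gamma> k j) x"
    note d = this
    have IH: "1 \<le> \<bar>b0\<bar>" "\<bar>b0\<bar> \<le> \<bar>b1\<bar>" using Suc.IH unfolding d by auto
    have "(p + r) * \<bar>b1\<bar> - r * \<bar>b1\<bar> \<le> (p + r) * (\<bar>x\<bar> * \<bar>b1\<bar>) - r * \<bar>b0\<bar>"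
      using pr IH mult_right_mono[OF assms(4), of "\<bar>b1\<bar>"]
      by (intro diff_mono mult_left_mono) auto
    also have "\<dots> = \<bar>(p + r) * x * b1\<bar> - \<bar>r * b0\<bar>" using pr by (simp add: abs_mult)
    also have "\<dots> \<le> \<bar>p * b2\<bar>" unfolding e[folded d] by simp
    also have "\<dots> = p * \<bar>b2\<bar>" using pr by (simp add: abs_mult)
    finally have "p * \<bar>b1\<bar> \<le> p * \<bar>b2\<bar>" by (simp add: algebra_simps)
    hence "\<bar>b1\<bar> \<le> \<bar>b2\<bar>" using pr by simp
    thus ?case using IH unfolding d by (simp del: sieved_B.simps)
  qed
  thus ?thesis by blast
qed

lemma sieved_B_nonzero:
  assumes "k \<ge> 2" "\<alpha> > -1/2" "\<gamma> > -1"
  shows "sieved_B \<alpha> \<gamma> k j \<noteq> 0"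
  using sieved_B_abs_ge_1[OF assms, of 1 j] by auto

lemma sieved_zero_count_shift:
  assumes "k \<ge> 2" "\<alpha> > -1/2" "\<gamma> > -1"
  shows "\<bar>real (sieved_zero_count \<alpha> \<gamma> k (j + d) y) - real (sieved_zero_count \<alpha> \<gamma> k j y)\<bar> \<le> real d"
proof (induction d)
  case (Suc d)
  have "\<bar>real (sieved_zero_count \<alpha> \<gamma> k (Suc (j + d)) y)
      - real (sieved_zero_count \<alpha> \<gamma> k (j + d) y)\<bar> \<le> 1"
    using wronskian_pos_card_le[OF sieved_B_wronskian_pos[OF assms]
        sieved_B_nonzero[OF assms] sieved_B_nonzero[OF assms], of y "j + d"]
    unfolding sieved_zero_count_def by linarith
  with Suc show ?case by simp
qed simp

section \<open>Generalized Gegenbauer polynomials: ladder relations and differential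
  equation\<close>

text \<open>This and \<open>gegenbauer_trail\<close> are the coefficients of B_{nk} and B_{nk-2} in
  the relation at index nk. For either parity they add up to 2\<alpha> + \<gamma> + 2n.\<close>

definition gegenbauer_lead :: "real \<Rightarrow> nat \<Rightarrow> real" where
  "gegenbauer_lead \<gamma> n = (if even n then real n else real n + \<gamma>)"

definition gegenbauer_trail :: "real \<Rightarrow> real \<Rightarrow> nat \<Rightarrow> real" where
  "gegenbauer_trail \<alpha> \<gamma> n = (if even n then 2 * \<alpha> + \<gamma> + real n else real n + 2 * \<alpha>)"

text \<open>Multiples of the orthogonal polynomials for the weight
  \<open>(1 - w\<^sup>2)\<^bsup>\<alpha> + 1/2\<^esup> \<bar>w\<bar>\<^bsup>\<gamma>\<^esup>\<close> on \<open>[-1, 1]\<close>.\<close>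

fun gen_gegenbauer :: "real \<Rightarrow> real \<Rightarrow> nat \<Rightarrow> real poly" where
  "gen_gegenbauer \<alpha> \<gamma> 0 = 1"
| "gen_gegenbauer \<alpha> \<gamma> (Suc 0) = [:0, (2 * \<alpha> + \<gamma> + 2) / (1 + \<gamma>):]"
| "gen_gegenbauer \<alpha> \<gamma> (Suc (Suc n)) = smult (1 / gegenbauer_lead \<gamma> (Suc (Suc n)))
     (smult (2 * \<alpha> + \<gamma> + 2 * real (Suc (Suc n))) ([:0, 1:] * gen_gegenbauer \<alpha> \<gamma> (Suc n))
       - smult (gegenbauer_trail \<alpha> \<gamma> (Suc (Suc n))) (gen_gegenbauer \<alpha> \<gamma> n))"

lemma gegenbauer_lead_pos: "\<gamma> > -1 \<Longrightarrow> n \<ge> 1 \<Longrightarrow> gegenbauer_lead \<gamma> n > 0"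
  by (auto simp: gegenbauer_lead_def)

lemma gen_gegenbauer_rec:
  assumes "\<gamma> > -1"
  shows "gegenbauer_lead \<gamma> (Suc (Suc n)) * poly (gen_gegenbauer \<alpha> \<gamma> (Suc (Suc n))) w =
    (2 * \<alpha> + \<gamma> + 2 * real (Suc (Suc n))) * w * poly (gen_gegenbauer \<alpha> \<gamma> (Suc n)) w
      - gegenbauer_trail \<alpha> \<gamma> (Suc (Suc n)) * poly (gen_gegenbauer \<alpha> \<gamma> n) w"
  using gegenbauer_lead_pos[OF assms, of "Suc (Suc n)"] by (simp add: field_simps)

lemma gen_gegenbauer_rec_deriv:
  assumes "\<gamma> > -1"
  shows "gegenbauer_lead \<gamma> (Suc (Suc n)) * poly (pderiv (gen_gegenbauer \<alpha> \<gamma> (Suc (Suc n)))) w =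
    (2 * \<alpha> + \<gamma> + 2 * real (Suc (Suc n))) *
       (poly (gen_gegenbauer \<alpha> \<gamma> (Suc n)) w + w * poly (pderiv (gen_gegenbauer \<alpha> \<gamma> (Suc n))) w)
      - gegenbauer_trail \<alpha> \<gamma> (Suc (Suc n)) * poly (pderiv (gen_gegenbauer \<alpha> \<gamma> n)) w"
  using gegenbauer_lead_pos[OF assms, of "Suc (Suc n)"]
  by (simp add: field_simps pderiv_smult pderiv_diff pderiv_mult pderiv_pCons)

text \<open>The lowering relation (first) and the raising relation (second) need each other in the
  induction. Lowering at n+2 comes from the differentiated recurrence together with lowering at n+1
  and raising at n; raising at n+1 comes from lowering at n+1 by eliminating S_n. All dependence on
  parity outside the recurrence coefficients sits in \<open>g\<close>.\<close>

lemma gen_gegenbauer_ladder: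
  fixes \<alpha> \<gamma> w :: real
  defines "S \<equiv> \<lambda>n. poly (gen_gegenbauer \<alpha> \<gamma> n) w"
    and "D \<equiv> \<lambda>n. poly (pderiv (gen_gegenbauer \<alpha> \<gamma> n)) w"
    and "g \<equiv> \<lambda>n::nat. if odd n then \<gamma> else 0"
  assumes \<gamma>: "\<gamma> > -1"
  shows "w * (1 - w\<^sup>2) * D (Suc n)
      = (- real (Suc n) * w\<^sup>2 - g (Suc n)) * S (Suc n) + gegenbauer_trail \<alpha> \<gamma> (Suc (Suc n)) * w * S n"
    and "w * (1 - w\<^sup>2) * D n
      = ((2 * \<alpha> + \<gamma> + real n + 2) * w\<^sup>2 - g n) * S n - gegenbauer_lead \<gamma> (Suc n) * w * S (Suc n)"
proof (induction n)
  case 0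
  { case 1
    show ?case using \<gamma> by (simp add: S_def D_def g_def gegenbauer_trail_def pderiv_pCons field_simps)
  next
    case 2
    show ?case using \<gamma> by (simp add: S_def D_def g_def gegenbauer_lead_def power2_eq_square)
  }
next
  case (Suc n)
  define p r q where "p = gegenbauer_lead \<gamma> (Suc (Suc n))" "r = gegenbauer_trail \<alpha> \<gamma> (Suc (Suc n))"
    "q = 2 * \<alpha> + \<gamma> + 2 * real (Suc (Suc n))"
  note pqr = this
  have p: "p > 0" using gegenbauer_lead_pos[OF \<gamma>] by (simp add: pqr)
  have rec: "p * S (Suc (Suc n)) = q * w * S (Suc n) - r * S n"
    unfolding pqr S_def by (rule gen_gegenbauer_rec[OF \<gamma>])
  have recd: "p * D (Suc (Suc n)) = q * (S (Suc n) + w * D (Suc n)) - r * D n"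
    unfolding pqr S_def D_def by (rule gen_gegenbauer_rec_deriv[OF \<gamma>])
  note IH1 = Suc.IH(1)[folded pqr]
  note IH2 = Suc.IH(2)
  { case 2
    have "r * w * S n = w * (q * w * S (Suc n) - p * S (Suc (Suc n)))"
      unfolding rec by (simp add: algebra_simps)
    thus ?case unfolding IH1 by (simp add: pqr algebra_simps power2_eq_square)
  next
    case 1
    define G where "G = (- real (Suc (Suc n)) * w\<^sup>2 - g (Suc (Suc n)))"
    have c0: "r * q * w\<^sup>2 - r * ((2 * \<alpha> + \<gamma> + real n + 2) * w\<^sup>2 - g n) = - r * G"
      by (simp add: pqr G_def g_def algebra_simps)
    \<comment> \<open>Comparing the parts without w^2 in the coefficients of w S_{n+1} leaves this
      identity between recurrence coefficients, which is checked separately for each parity.\<close>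
    have key: "q + r * gegenbauer_lead \<gamma> (Suc n) - q * g (Suc n)
        = p * gegenbauer_trail \<alpha> \<gamma> (Suc (Suc (Suc n))) - g (Suc (Suc n)) * q"
      by (cases "even n") (simp_all add: pqr gegenbauer_lead_def gegenbauer_trail_def g_def algebra_simps)
    have c1: "q * (w * (1 - w\<^sup>2)) + q * w * (- real (Suc n) * w\<^sup>2 - g (Suc n))
        + r * gegenbauer_lead \<gamma> (Suc n) * w = G * q * w + p * gegenbauer_trail \<alpha> \<gamma> (Suc (Suc (Suc n))) * w"
    proof -
      have "q * (w * (1 - w\<^sup>2)) + q * w * (- real (Suc n) * w\<^sup>2 - g (Suc n))
        + r * gegenbauer_lead \<gamma> (Suc n) * w
        = w * (q + r * gegenbauer_lead \<gamma> (Suc n) - q * g (Suc n)) - q * real (Suc (Suc n)) * w * w\<^sup>2"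
        by (simp add: algebra_simps)
      also have "\<dots> = G * q * w + p * gegenbauer_trail \<alpha> \<gamma> (Suc (Suc (Suc n))) * w"
        unfolding key G_def by (simp add: algebra_simps)
      finally show ?thesis .
    qed
    have "p * (w * (1 - w\<^sup>2) * D (Suc (Suc n))) = (w * (1 - w\<^sup>2)) * (p * D (Suc (Suc n)))"
      by simp
    also have "\<dots> = q * (w * (1 - w\<^sup>2)) * S (Suc n) + q * w * (w * (1 - w\<^sup>2) * D (Suc n))
          - r * (w * (1 - w\<^sup>2) * D n)"
      unfolding recd by (simp add: algebra_simps)
    also have "\<dots> = (q * (w * (1 - w\<^sup>2)) + q * w * (- real (Suc n) * w\<^sup>2 - g (Suc n))
        + r * gegenbauer_lead \<gamma> (Suc n) * w) * S (Suc n)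
        + (r * q * w\<^sup>2 - r * ((2 * \<alpha> + \<gamma> + real n + 2) * w\<^sup>2 - g n)) * S n"
      unfolding IH1 IH2 by (simp add: algebra_simps power2_eq_square)
    also have "\<dots> = G * (q * w * S (Suc n) - r * S n)
        + p * gegenbauer_trail \<alpha> \<gamma> (Suc (Suc (Suc n))) * w * S (Suc n)"
      unfolding c0 c1 by (simp add: algebra_simps)
    also have "\<dots> = p * (G * S (Suc (Suc n)) + gegenbauer_trail \<alpha> \<gamma> (Suc (Suc (Suc n))) * w * S (Suc n))"
      unfolding rec[symmetric] by (simp add: algebra_simps)
    finally show ?case using p by (simp add: G_def)
  }
qed

text \<open>Differentiate the lowering relation for n = m+1 and eliminate S_m and its derivative
  with the two ladder relations. The elimination yields the equation multiplied by w(1 - w^2), hence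
  the excluded points.\<close>

lemma gen_gegenbauer_ode:
  fixes \<alpha> \<gamma> w :: real
  assumes \<gamma>: "\<gamma> > -1" and n: "odd n" and w: "w \<noteq> 0" "w\<^sup>2 \<noteq> 1"
  shows "w\<^sup>2 * (1 - w\<^sup>2) * poly (pderiv (pderiv (gen_gegenbauer \<alpha> \<gamma> n))) w
    = ((2 * \<alpha> + 3 + \<gamma>) * w\<^sup>2 - \<gamma>) * w * poly (pderiv (gen_gegenbauer \<alpha> \<gamma> n)) w
      - (real n * (real n + 2 * \<alpha> + 2 + \<gamma>) * w\<^sup>2 - \<gamma>) * poly (gen_gegenbauer \<alpha> \<gamma> n) w"
proof -
  obtain m where m: "n = Suc m" using n by (cases n) auto
  define r p where "r = 2 * \<alpha> + \<gamma> + real n + 1" "p = real n + \<gamma>"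
  note rp = this
  let ?S = "gen_gegenbauer \<alpha> \<gamma> n" and ?T = "gen_gegenbauer \<alpha> \<gamma> m"
  have 1: "x * (1 - x\<^sup>2) * poly (pderiv ?S) x = (- real n * x\<^sup>2 - \<gamma>) * poly ?S x + r * x * poly ?T x" for x
    using gen_gegenbauer_ladder(1)[OF \<gamma>, of x \<alpha> m] n by (simp add: m rp gegenbauer_trail_def algebra_simps)
  have 2: "x * (1 - x\<^sup>2) * poly (pderiv ?T) x = r * x\<^sup>2 * poly ?T x - p * x * poly ?S x" for x
    using gen_gegenbauer_ladder(2)[OF \<gamma>, of x \<alpha> m] n by (simp add: m rp gegenbauer_lead_def algebra_simps)
  \<comment> \<open>The pointwise relation is lifted to an identity of polynomials so that it can be
    differentiated.\<close>
  have "[:0, 1, 0, -1:] * pderiv ?S = [:-\<gamma>, 0, - real n:] * ?S + smult r ([:0, 1:] * ?T)"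
    using 1 by (intro poly_ext) (simp add: algebra_simps power2_eq_square)
  hence "poly (pderiv ([:0, 1, 0, -1:] * pderiv ?S)) w
      = poly (pderiv ([:-\<gamma>, 0, - real n:] * ?S + smult r ([:0, 1:] * ?T))) w"
    by (rule arg_cong)
  define s d e t u where "s = poly ?S w" "d = poly (pderiv ?S) w"
    "e = poly (pderiv (pderiv ?S)) w" "t = poly ?T w" "u = poly (pderiv ?T) w"
  note sdetu = this
  have 3: "(1 - 3 * w\<^sup>2) * d + w * (1 - w\<^sup>2) * e
      = - 2 * real n * w * s + (- real n * w\<^sup>2 - \<gamma>) * d + r * t + r * w * u"
    using \<open>poly (pderiv ([:0, 1, 0, -1:] * pderiv ?S)) w = _\<close>
    unfolding pderiv_mult pderiv_add pderiv_smult
    by (simp add: pderiv_pCons sdetu algebra_simps power2_eq_square)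
  note 1 = 1[of w, folded sdetu] and 2 = 2[of w, folded sdetu]
  let ?E = "w * (1 - w\<^sup>2)"
  have "?E * (w\<^sup>2 * (1 - w\<^sup>2) * e - (((2 * \<alpha> + 3 + \<gamma>) * w\<^sup>2 - \<gamma>) * w * d
      - (real n * (real n + 2 * \<alpha> + 2 + \<gamma>) * w\<^sup>2 - \<gamma>) * s)) = 0"
    using 1 2 3 unfolding rp by algebra
  moreover have "?E \<noteq> 0" using w by simp
  ultimately show ?thesis unfolding sdetu by simp
qed

section \<open>The subsequence of index nk-1 as Chebyshev factor times Gegenbauer polynomial\<close>

text \<open>Here u is the solution with initial values 0, 1, so any solution of the unsieved
  recurrence on a block is determined by its first two values. It is used forwards and backwards
  from index nk-1.\<close>

lemma chebyshev_block:
  fixes d u :: "nat \<Rightarrow> real"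
  assumes d: "\<And>j. Suc (Suc j) \<le> k \<Longrightarrow> d (Suc (Suc j)) = 2 * x * d (Suc j) - d j"
    and u: "u 0 = 0" "u 1 = 1" "\<And>j. u (Suc (Suc j)) = 2 * x * u (Suc j) - u j"
    and "Suc j \<le> k"
  shows "d (Suc j) = u (Suc j) * d 1 - u j * d 0"
  using \<open>Suc j \<le> k\<close>
proof (induction j rule: induct_nat_012)
  case 1
  thus ?case using d[of 0] u(3)[of 0] u(1,2) by simp
next
  case (ge2 n)
  hence "d (Suc (Suc (Suc n))) = 2 * x * d (Suc (Suc n)) - d (Suc n)"
    "d (Suc n) = u (Suc n) * d 1 - u n * d 0"
    "d (Suc (Suc n)) = u (Suc (Suc n)) * d 1 - u (Suc n) * d 0" using d[of "Suc n"] by auto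
  thus ?case using u(3)[of n] u(3)[of "Suc n"] by algebra
qed (use u in auto)

text \<open>\<open>U\<^bsub>k - 1\<^esub>\<close> with the convention \<open>U\<^bsub>-1\<^esub> = 0\<close>.\<close>

definition cheb_V :: "nat \<Rightarrow> real \<Rightarrow> real" where
  "cheb_V k x = (if k = 0 then 0 else poly (cheb_U (k - 1)) x)"

lemma cheb_V_rec:
  "cheb_V 0 x = 0" "cheb_V 1 x = 1"
  "cheb_V (Suc (Suc j)) x = 2 * x * cheb_V (Suc j) x - cheb_V j x"
  by (simp_all add: cheb_V_def) (cases j, auto simp: cheb_V_def)

lemma cheb_T_eq_V: "poly (cheb_T (Suc j)) x = x * cheb_V (Suc j) x - cheb_V j x"
proof (induction j rule: induct_nat_012)
  case 1
  thus ?case using cheb_V_rec(3)[of 0 x] cheb_V_rec(1,2)[of x] by (simp add: algebra_simps)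
next
  case (ge2 n)
  moreover have "poly (cheb_T (Suc (Suc (Suc n)))) x
      = 2 * x * poly (cheb_T (Suc (Suc n))) x - poly (cheb_T (Suc n)) x"
    by (simp del: cheb_T.simps add: cheb_T.simps(3)[of "Suc n"])
  ultimately show ?case using cheb_V_rec(3)[of n x] cheb_V_rec(3)[of "Suc n" x] by algebra
qed (simp add: cheb_V_def)

lemma sieved_B_eq_V:
  assumes "Suc j \<le> k" "k \<ge> 2"
  shows "poly (sieved_B \<alpha> \<gamma> k j) x = cheb_V (Suc j) x"
  using assms(1)
proof (induction j rule: induct_nat_012)
  case (ge2 n)
  have "\<not> k dvd Suc (Suc n)" using ge2.prems by (auto dest: dvd_imp_le)
  with ge2 cheb_V_rec(3)[of "Suc n" x] show ?case by simp
qed (simp_all add: cheb_V_def)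

text \<open>Both \<open>B\<^bsub>(n+1)k-1\<^esub>\<close> and \<open>B\<^bsub>(n-1)k-1\<^esub>\<close> are combinations of two neighbours of \<open>B\<^bsub>nk-1\<^esub>\<close>,
  and the relation at \<open>nk\<close> eliminates \<open>B\<^bsub>nk\<^esub>\<close> and \<open>B\<^bsub>nk-2\<^esub>\<close>.\<close>

lemma sieved_B_subsequence_rec:
  assumes k: "k \<ge> 2" and \<gamma>: "\<gamma> > -1" and n: "n \<ge> 1"
  shows "gegenbauer_lead \<gamma> n * poly (sieved_B \<alpha> \<gamma> k (Suc n * k - 1)) x
       + (if n = 1 then 0 else gegenbauer_trail \<alpha> \<gamma> n * poly (sieved_B \<alpha> \<gamma> k ((n - 1) * k - 1)) x)
       = (2 * \<alpha> + \<gamma> + 2 * real n) * poly (cheb_T k) x * poly (sieved_B \<alpha> \<gamma> k (n * k - 1)) x"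
proof -
  define b where "b j = poly (sieved_B \<alpha> \<gamma> k j) x" for j
  define u where "u j = cheb_V j x" for j
  define q where "q = 2 * \<alpha> + \<gamma> + 2 * real n"
  have nk: "n * k \<ge> k" using n by simp
  obtain k' where k': "k = Suc k'" using k by (cases k) auto
  have brec: "b (Suc (Suc j)) = 2 * x * b (Suc j) - b j" if "\<not> k dvd Suc (Suc j)" for j
    using that by (simp add: b_def)
  \<comment> \<open>The forward block runs from nk-1 to (n+1)k-1. Its new members up to the last
    have indices nk + i with 0 < i < k, where no sieved relation intervenes.\<close>
  have fwd: "b (n * k - 1 + Suc j) = u (Suc j) * b (n * k - 1 + 1) - u j * b (n * k - 1 + 0)"
    if "Suc j \<le> k" for j
  proof (rule chebyshev_block[where d = "\<lambda>j. b (n * k - 1 + j)" and x = x and k = k])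
    fix i assume i: "Suc (Suc i) \<le> k"
    have "\<not> k dvd Suc i" using i by (auto dest: dvd_imp_le)
    hence "\<not> k dvd n * k + Suc i" by (subst dvd_add_right_iff) auto
    moreover have "Suc (Suc (n * k - 1 + i)) = n * k + Suc i" using nk k by simp
    ultimately have "\<not> k dvd Suc (Suc (n * k - 1 + i))" by (simp only: not_False_eq_True)
    thus "b (n * k - 1 + Suc (Suc i)) = 2 * x * b (n * k - 1 + Suc i) - b (n * k - 1 + i)"
      unfolding add_Suc_right by (rule brec)
  qed (use that cheb_V_rec in \<open>auto simp: u_def\<close>)
  have top: "b (Suc n * k - 1) = u k * b (n * k) - u k' * b (n * k - 1)"
  proof -
    have "n * k - 1 + Suc k' = Suc n * k - 1" "n * k - 1 + 1 = n * k" "Suc k' = k" using nk k k' by auto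
    thus ?thesis using fwd[of k'] by (simp only: add_0_right)
  qed
  have T: "poly (cheb_T k) x = x * u k - u k'" by (simp add: k' u_def cheb_T_eq_V)
  have mid: "q * x * b (n * k - 1) = gegenbauer_lead \<gamma> n * b (n * k) + gegenbauer_trail \<alpha> \<gamma> n * b (n * k - 2)"
  proof (cases "even n")
    case True
    from arg_cong[OF sieved_B_even[OF k n \<gamma> True, of \<alpha>], of "\<lambda>p. poly p x"] True
    show ?thesis by (simp add: b_def q_def gegenbauer_lead_def gegenbauer_trail_def mult.assoc mult.left_commute)
  next
    case False
    from arg_cong[OF sieved_B_odd[OF k n \<gamma> False, of \<alpha>], of "\<lambda>p. poly p x"] False
    show ?thesis by (simp add: b_def q_def gegenbauer_lead_def gegenbauer_trail_def mult.assoc mult.left_commute)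
  qed
  have pr: "gegenbauer_lead \<gamma> n + gegenbauer_trail \<alpha> \<gamma> n = q" by (simp add: gegenbauer_lead_def gegenbauer_trail_def q_def)
  \<comment> \<open>For n = 1 the member wanted is B_{-1} = 0. Truncated subtraction would turn its
    index into 0, where B_0 = 1, so the case is separated.\<close>
  have bot: "(if n = 1 then 0 else b ((n - 1) * k - 1)) = u k * b (n * k - 2) - u k' * b (n * k - 1)"
  proof (cases "n = 1")
    case True
    have "b (k - 1) = u k" "b (k - 2) = u k'"
      using sieved_B_eq_V[of "k - 1" k \<alpha> \<gamma> x] sieved_B_eq_V[of "k - 2" k \<alpha> \<gamma> x] k
      by (auto simp: b_def u_def k' Suc_diff_Suc numeral_2_eq_2)
    thus ?thesis using True by simp
  next
    case False
    hence "n \<ge> 2" using n by simp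
    hence nk2: "n * k \<ge> 2 * k" by (intro mult_right_mono) auto
    have bwd: "b (n * k - 1 - Suc j) = u (Suc j) * b (n * k - 1 - 1) - u j * b (n * k - 1 - 0)"
      if "Suc j \<le> k" for j
    proof (rule chebyshev_block[where d = "\<lambda>j. b (n * k - 1 - j)" and x = x and k = k])
      fix i assume i: "Suc (Suc i) \<le> k"
      have "\<not> k dvd n * k - Suc i"
      proof
        assume "k dvd n * k - Suc i"
        moreover have "k dvd n * k" by simp
        ultimately have "k dvd n * k - (n * k - Suc i)" by (rule dvd_diff_nat[rotated])
        moreover have "n * k - (n * k - Suc i) = Suc i" using i nk by (intro diff_diff_cancel) linarith
        ultimately have "k dvd Suc i" by simp
        thus False using i by (auto dest: dvd_imp_le)
      qed
      moreover have "Suc (Suc (Suc i)) \<le> n * k" using nk2 i k by linarith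
      then obtain N where N: "n * k = Suc (Suc (Suc i)) + N" using le_Suc_ex by blast
      ultimately have "\<not> k dvd Suc (Suc N)" by simp
      have e: "n * k - 1 - i = Suc (Suc N)" "n * k - 1 - Suc i = Suc N"
        "n * k - 1 - Suc (Suc i) = N" unfolding N by simp_all
      have "b (n * k - 1 - i) = 2 * x * b (n * k - 1 - Suc i) - b (n * k - 1 - Suc (Suc i))"
        using brec[OF \<open>\<not> k dvd Suc (Suc N)\<close>] by (simp only: e)
      thus "b (n * k - 1 - Suc (Suc i)) = 2 * x * b (n * k - 1 - Suc i) - b (n * k - 1 - i)"
        by simp
    qed (use that cheb_V_rec in \<open>auto simp: u_def\<close>)
    have "(n - 1) * k - 1 = n * k - 1 - k" by (simp add: diff_mult_distrib)
    moreover have "b (n * k - 1 - k) = u k * b (n * k - 1 - 1) - u k' * b (n * k - 1 - 0)"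
      using bwd[of k', folded k'] by simp
    moreover have "n * k - 1 - 1 = n * k - 2" by simp
    ultimately show ?thesis using False by simp
  qed
  have "gegenbauer_lead \<gamma> n * b (Suc n * k - 1) + gegenbauer_trail \<alpha> \<gamma> n * (if n = 1 then 0 else b ((n - 1) * k - 1))
      = u k * (gegenbauer_lead \<gamma> n * b (n * k) + gegenbauer_trail \<alpha> \<gamma> n * b (n * k - 2))
         - u k' * (gegenbauer_lead \<gamma> n + gegenbauer_trail \<alpha> \<gamma> n) * b (n * k - 1)"
    unfolding top bot by (simp add: algebra_simps)
  also have "\<dots> = q * poly (cheb_T k) x * b (n * k - 1)"
    unfolding mid[symmetric] pr T by (simp add: algebra_simps)
  finally show ?thesis by (cases "n = 1") (simp_all add: b_def q_def)
qed

text \<open>Both sides satisfy the three-term relation of \<open>sieved_B_subsequence_rec\<close>;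
  the factor U_{k-1} does not depend on n and comes from B_{k-1} = U_{k-1}.\<close>

lemma sieved_B_factor:
  assumes k: "k \<ge> 2" and \<gamma>: "\<gamma> > -1"
  shows "poly (sieved_B \<alpha> \<gamma> k (Suc n * k - 1)) x
    = poly (cheb_U (k - 1)) x * poly (gen_gegenbauer \<alpha> \<gamma> n) (poly (cheb_T k) x)"
proof (induction n rule: induct_nat_012)
  case 0
  show ?case using sieved_B_eq_V[of "k - 1" k \<alpha> \<gamma> x] k by (simp add: cheb_V_def)
next
  \<comment> \<open>The term with B_{-1} is absent, and the relation at n = 1 is what dictates the
    coefficient (2\<alpha> + \<gamma> + 2)/(1 + \<gamma>) of S_1.\<close>
  case 1
  have "gegenbauer_lead \<gamma> 1 \<noteq> 0" using gegenbauer_lead_pos[OF \<gamma>, of 1] by simp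
  with sieved_B_subsequence_rec[OF k \<gamma>, of 1 \<alpha> x] sieved_B_eq_V[of "k - 1" k \<alpha> \<gamma> x] k
  show ?case by (simp add: cheb_V_def gegenbauer_lead_def field_simps)
next
  case (ge2 n)
  define s where "s j = poly (gen_gegenbauer \<alpha> \<gamma> j) (poly (cheb_T k) x)" for j
  define u where "u = poly (cheb_U (k - 1)) x"
  define q where "q = 2 * \<alpha> + \<gamma> + 2 * real (Suc (Suc n))"
  note sieved_B_subsequence_rec[OF k \<gamma>, of "Suc (Suc n)" \<alpha> x]
  hence "gegenbauer_lead \<gamma> (Suc (Suc n)) * poly (sieved_B \<alpha> \<gamma> k (Suc (Suc (Suc n)) * k - 1)) x
      = q * poly (cheb_T k) x * (u * s (Suc n)) - gegenbauer_trail \<alpha> \<gamma> (Suc (Suc n)) * (u * s n)"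
    using ge2 unfolding s_def u_def q_def by simp
  also have "\<dots> = u * (q * poly (cheb_T k) x * s (Suc n) - gegenbauer_trail \<alpha> \<gamma> (Suc (Suc n)) * s n)"
    by (simp add: algebra_simps)
  also have "\<dots> = gegenbauer_lead \<gamma> (Suc (Suc n)) * (u * s (Suc (Suc n)))"
    using gen_gegenbauer_rec[OF \<gamma>, of n \<alpha> "poly (cheb_T k) x"]
    unfolding s_def q_def by (simp only: mult.left_commute)
  finally have "poly (sieved_B \<alpha> \<gamma> k (Suc (Suc (Suc n)) * k - 1)) x = u * s (Suc (Suc n))"
    by (rule mult_left_cancel[THEN iffD1, rotated]) (use gegenbauer_lead_pos[OF \<gamma>, of "Suc (Suc n)"] in simp)
  thus ?case unfolding s_def u_def .
qed

section \<open>Liouville normal form\<close>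

text \<open>\<open>trig_weight \<rho> \<sigma> k t = \<bar>sin (k t)\<bar>\<^sup>\<rho> \<bar>cos (k t)\<bar>\<^sup>\<sigma>\<close>, written so that it is
  visibly differentiable wherever \<open>sin (2 k t) \<noteq> 0\<close>.\<close>

definition trig_weight :: "real \<Rightarrow> real \<Rightarrow> real \<Rightarrow> real \<Rightarrow> real" where
  "trig_weight \<rho> \<sigma> k t =
     exp (\<rho> / 2 * ln ((sin (k * t))\<^sup>2) + \<sigma> / 2 * ln ((cos (k * t))\<^sup>2))"

definition trig_logderiv :: "real \<Rightarrow> real \<Rightarrow> real \<Rightarrow> real \<Rightarrow> real" where
  "trig_logderiv \<rho> \<sigma> k t =
     k * (\<rho> * cos (k * t) / sin (k * t) - \<sigma> * sin (k * t) / cos (k * t))"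

lemma trig_weight_pos: "trig_weight \<rho> \<sigma> k t > 0"
  by (simp add: trig_weight_def)

lemma has_derivative_trig_weight:
  assumes "sin (k * t) \<noteq> 0" "cos (k * t) \<noteq> 0"
  shows "(trig_weight \<rho> \<sigma> k has_real_derivative
           trig_weight \<rho> \<sigma> k t * trig_logderiv \<rho> \<sigma> k t) (at t)"
  unfolding trig_weight_def[abs_def] trig_logderiv_def using assms
  by (auto intro!: derivative_eq_intros) (simp add: field_simps power2_eq_square)

lemma has_derivative_trig_logderiv:
  assumes "sin (k * t) \<noteq> 0" "cos (k * t) \<noteq> 0"
  shows "(trig_logderiv \<rho> \<sigma> k has_real_derivative
           - k\<^sup>2 * (\<rho> / (sin (k * t))\<^sup>2 + \<sigma> / (cos (k * t))\<^sup>2)) (at t)"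
proof -
  define s c where "s = sin (k * t)" "c = cos (k * t)"
  note sc = this
  have nz: "s \<noteq> 0" "c \<noteq> 0" using assms by (auto simp: sc)
  have 1: "s\<^sup>2 + c\<^sup>2 = 1" by (simp add: sc)
  have "(trig_logderiv \<rho> \<sigma> k has_real_derivative
     k * (\<rho> * (- (s * k) * s - c * (c * k)) / s\<^sup>2 - \<sigma> * (c * k * c - s * (- (s * k))) / c\<^sup>2)) (at t)"
    unfolding trig_logderiv_def[abs_def] using assms
    by (auto intro!: derivative_eq_intros simp: sc field_simps power2_eq_square)
  also have "- (s * k) * s - c * (c * k) = - k * (s\<^sup>2 + c\<^sup>2)"
    by (simp add: algebra_simps power2_eq_square)
  also have "c * k * c - s * (- (s * k)) = k * (s\<^sup>2 + c\<^sup>2)"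
    by (simp add: algebra_simps power2_eq_square)
  finally show ?thesis unfolding 1 sc[symmetric] using nz
    by (simp add: field_simps power2_eq_square)
qed

text \<open>Liouville normal form \<open>F'' + Q F = 0\<close> of the differential equation of \<open>S\<^sub>n (cos (k t))\<close>.
  The formula for \<open>Q\<close> is valid for odd \<open>n\<close> only.\<close>

definition liouville_F :: "real \<Rightarrow> real \<Rightarrow> real \<Rightarrow> nat \<Rightarrow> real \<Rightarrow> real" where
  "liouville_F \<alpha> \<gamma> k n t = trig_weight (\<alpha> + 1) (\<gamma> / 2) k t * poly (gen_gegenbauer \<alpha> \<gamma> n) (cos (k * t))"

definition liouville_F1 :: "real \<Rightarrow> real \<Rightarrow> real \<Rightarrow> nat \<Rightarrow> real \<Rightarrow> real" where
  "liouville_F1 \<alpha> \<gamma> k n t = trig_weight (\<alpha> + 1) (\<gamma> / 2) k t *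
     (trig_logderiv (\<alpha> + 1) (\<gamma> / 2) k t * poly (gen_gegenbauer \<alpha> \<gamma> n) (cos (k * t))
       - k * sin (k * t) * poly (pderiv (gen_gegenbauer \<alpha> \<gamma> n)) (cos (k * t)))"

definition liouville_Q :: "real \<Rightarrow> real \<Rightarrow> real \<Rightarrow> nat \<Rightarrow> real \<Rightarrow> real" where
  "liouville_Q \<alpha> \<gamma> k n t = k\<^sup>2 * ((real n + \<alpha> + 1 + \<gamma> / 2)\<^sup>2
     - \<alpha> * (\<alpha> + 1) / (sin (k * t))\<^sup>2 - \<gamma> * (\<gamma> + 2) / 4 / (cos (k * t))\<^sup>2)"

lemma has_derivative_liouville_F:
  assumes "sin (k * t) \<noteq> 0" "cos (k * t) \<noteq> 0"
  shows "(liouville_F \<alpha> \<gamma> k n has_real_derivative liouville_F1 \<alpha> \<gamma> k n t) (at t)"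
  unfolding liouville_F_def[abs_def] liouville_F1_def
  by (rule derivative_eq_intros has_derivative_trig_weight[OF assms] refl poly_DERIV
      DERIV_chain2[of "poly p" for p])+ (simp add: algebra_simps)

text \<open>The exponents \<alpha>+1 and \<gamma>/2 of the weight are those that cancel the
  first-order term. The weight contributes (\<alpha>+1)^2 - (\<alpha>+1) = \<alpha>(\<alpha>+1) at
  the zeros of sine and \<gamma>(\<gamma>-2)/4 at those of cosine; the term \<gamma> of the equation
  for odd n raises the latter to \<gamma>(\<gamma>+2)/4.\<close>

lemma has_derivative_liouville_F1:
  assumes sc0: "sin (k * t) \<noteq> 0" "cos (k * t) \<noteq> 0" and \<gamma>: "\<gamma> > -1" and n: "odd n"
  shows "(liouville_F1 \<alpha> \<gamma> k n has_real_derivative - liouville_Q \<alpha> \<gamma> k n t * liouville_F \<alpha> \<gamma> k n t) (at t)"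
proof -
  define s c \<psi> l S D E where "s = sin (k * t)" "c = cos (k * t)"
    "\<psi> = trig_weight (\<alpha> + 1) (\<gamma> / 2) k t" "l = trig_logderiv (\<alpha> + 1) (\<gamma> / 2) k t"
    "S = poly (gen_gegenbauer \<alpha> \<gamma> n) c" "D = poly (pderiv (gen_gegenbauer \<alpha> \<gamma> n)) c"
    "E = poly (pderiv (pderiv (gen_gegenbauer \<alpha> \<gamma> n))) c"
  note d = this
  have nz: "s \<noteq> 0" "c \<noteq> 0" using sc0 by (auto simp: d)
  have s2: "s\<^sup>2 = 1 - c\<^sup>2" by (simp add: d sin_squared_eq)
  have "(liouville_F1 \<alpha> \<gamma> k n has_real_derivative
      \<psi> * l * (l * S - k * s * D)
      + \<psi> * (- k\<^sup>2 * ((\<alpha> + 1) / s\<^sup>2 + \<gamma> / 2 / c\<^sup>2) * S + l * (D * (- (s * k)))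
           - (k * (c * k) * D + k * s * (E * (- (s * k)))))) (at t)"
    unfolding liouville_F1_def[abs_def] d
    by (rule derivative_eq_intros has_derivative_trig_weight[OF sc0]
        has_derivative_trig_logderiv[OF sc0] refl poly_DERIV
        DERIV_chain2[of "poly p" for p])+ (simp add: algebra_simps)
  also have "\<psi> * l * (l * S - k * s * D)
      + \<psi> * (- k\<^sup>2 * ((\<alpha> + 1) / s\<^sup>2 + \<gamma> / 2 / c\<^sup>2) * S + l * (D * (- (s * k)))
           - (k * (c * k) * D + k * s * (E * (- (s * k)))))
      = - liouville_Q \<alpha> \<gamma> k n t * (\<psi> * S)"
  proof -
    have c2: "c\<^sup>2 \<noteq> 1" using s2 nz by auto
    have ode: "c\<^sup>2 * s\<^sup>2 * E = ((2 * \<alpha> + 3 + \<gamma>) * c\<^sup>2 - \<gamma>) * c * D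
        - (real n * (real n + 2 * \<alpha> + 2 + \<gamma>) * c\<^sup>2 - \<gamma>) * S"
      using gen_gegenbauer_ode[OF \<gamma> n nz(2) c2, of \<alpha>, folded d] unfolding s2 by simp
    have ls: "l = k * ((\<alpha> + 1) * c / s - \<gamma> / 2 * s / c)" by (simp add: d trig_logderiv_def)
    have E': "s\<^sup>2 * E = ((2 * \<alpha> + 3 + \<gamma>) * c - \<gamma> * (1 / c)) * D
        - (real n * (real n + 2 * \<alpha> + 2 + \<gamma>) - \<gamma> * (1 / c\<^sup>2)) * S"
    proof -
      have "c\<^sup>2 * (s\<^sup>2 * E) = c\<^sup>2 * (((2 * \<alpha> + 3 + \<gamma>) * c - \<gamma> * (1 / c)) * D
        - (real n * (real n + 2 * \<alpha> + 2 + \<gamma>) - \<gamma> * (1 / c\<^sup>2)) * S)"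
        using nz by (simp only: mult.assoc[symmetric] ode) (simp add: field_simps power2_eq_square)
      thus ?thesis using nz by simp
    qed
    have lsD: "2 * l * s = k * (2 * (\<alpha> + 1) * c - \<gamma> * (1 / c - c))"
    proof -
      have "2 * l * s = k * (2 * (\<alpha> + 1) * c - \<gamma> * (s\<^sup>2 / c))"
        using nz by (simp add: ls field_simps power2_eq_square)
      also have "s\<^sup>2 / c = 1 / c - c"
        using nz unfolding s2 by (simp add: diff_divide_distrib power2_eq_square)
      finally show ?thesis .
    qed
    have l2: "l\<^sup>2 = k\<^sup>2 * ((\<alpha> + 1)\<^sup>2 * (1 / s\<^sup>2 - 1) - (\<alpha> + 1) * \<gamma> + \<gamma>\<^sup>2 / 4 * (1 / c\<^sup>2 - 1))"
    proof -
      have "l\<^sup>2 = k\<^sup>2 * ((\<alpha> + 1)\<^sup>2 * (c\<^sup>2 / s\<^sup>2) - (\<alpha> + 1) * \<gamma> + \<gamma>\<^sup>2 / 4 * (s\<^sup>2 / c\<^sup>2))"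
        using nz by (simp add: ls power2_eq_square field_simps)
      also have "c\<^sup>2 / s\<^sup>2 = 1 / s\<^sup>2 - 1" using nz s2 by (simp add: field_simps)
      also have "s\<^sup>2 / c\<^sup>2 = 1 / c\<^sup>2 - 1" using nz s2 by (simp add: field_simps)
      finally show ?thesis .
    qed
    \<comment> \<open>With the reciprocals treated as atoms, the rest is a polynomial identity in
      which the terms with \<open>D\<close> cancel.\<close>
    define X Y V where "X = 1 / s\<^sup>2" "Y = 1 / c\<^sup>2" "V = 1 / c"
    note XY = this
    have "\<psi> * l * (l * S - k * s * D)
      + \<psi> * (- k\<^sup>2 * ((\<alpha> + 1) / s\<^sup>2 + \<gamma> / 2 / c\<^sup>2) * S + l * (D * (- (s * k)))
           - (k * (c * k) * D + k * s * (E * (- (s * k)))))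
      = \<psi> * (l\<^sup>2 * S - k * (2 * l * s) * D - k\<^sup>2 * ((\<alpha> + 1) * X + \<gamma> / 2 * Y) * S
          - k\<^sup>2 * c * D + k\<^sup>2 * (s\<^sup>2 * E))"
    proof -
      have "(\<alpha> + 1) / s\<^sup>2 + \<gamma> / 2 / c\<^sup>2 = (\<alpha> + 1) * X + \<gamma> / 2 * Y" by (simp add: XY)
      thus ?thesis by (simp only:) (simp add: algebra_simps power2_eq_square)
    qed
    also have "l\<^sup>2 * S - k * (2 * l * s) * D - k\<^sup>2 * ((\<alpha> + 1) * X + \<gamma> / 2 * Y) * S
          - k\<^sup>2 * c * D + k\<^sup>2 * (s\<^sup>2 * E)
       = k\<^sup>2 * (((\<alpha> + 1)\<^sup>2 * (X - 1) - (\<alpha> + 1) * \<gamma> + \<gamma>\<^sup>2 / 4 * (Y - 1)) * S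
           - (2 * (\<alpha> + 1) * c - \<gamma> * (V - c)) * D - ((\<alpha> + 1) * X + \<gamma> / 2 * Y) * S - c * D
           + (((2 * \<alpha> + 3 + \<gamma>) * c - \<gamma> * V) * D
        - (real n * (real n + 2 * \<alpha> + 2 + \<gamma>) - \<gamma> * Y) * S))"
      unfolding l2 lsD E' XY[symmetric] by (simp add: algebra_simps power2_eq_square)
    also have "\<dots> = - (k\<^sup>2 * ((real n + \<alpha> + 1 + \<gamma> / 2)\<^sup>2 - \<alpha> * (\<alpha> + 1) * X - \<gamma> * (\<gamma> + 2) / 4 * Y)) * S"
      by (simp add: field_simps power2_eq_square)
    also have "k\<^sup>2 * ((real n + \<alpha> + 1 + \<gamma> / 2)\<^sup>2 - \<alpha> * (\<alpha> + 1) * X - \<gamma> * (\<gamma> + 2) / 4 * Y) = liouville_Q \<alpha> \<gamma> k n t"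
      by (simp add: liouville_Q_def XY d)
    finally show ?thesis by simp
  qed
  finally show ?thesis by (simp add: liouville_F_def d)
qed

section \<open>Counting zeros of solutions\<close>

text \<open>Zeros are at least pi/\<omega> apart: on a shorter interval [x, y], cos(\<omega>(z - m))
  centred at the midpoint m would be a positive supersolution.\<close>

lemma count_zeros_le:
  fixes F F1 Q :: "real \<Rightarrow> real"
  assumes uv: "u \<le> v" and w: "\<omega> > 0" and fin: "finite {x \<in> {u..<v}. F x = 0}"
    and F: "\<And>x. x \<in> {u..<v} \<Longrightarrow> (F has_real_derivative F1 x) (at x)"
           "\<And>x. x \<in> {u..<v} \<Longrightarrow> (F1 has_real_derivative - Q x * F x) (at x)"
    and Q: "\<And>x. x \<in> {u..<v} \<Longrightarrow> Q x \<le> \<omega>\<^sup>2"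
  shows "real (card {x \<in> {u..<v}. F x = 0}) \<le> (v - u) * \<omega> / pi + 1"
proof -
  have "real (card {x \<in> {u..<v}. F x = 0}) \<le> (v - u) / (pi / \<omega>) + 1"
  proof (rule card_separated_le(2))
    fix x y assume xy: "x \<in> {x \<in> {u..<v}. F x = 0}" "y \<in> {x \<in> {u..<v}. F x = 0}" "x < y"
    show "y - x \<ge> pi / \<omega>"
    proof (rule ccontr)
      assume "\<not> ?thesis"
      hence less: "\<omega> * (y - x) < pi" using w by (simp add: field_simps)
      define m where "m = (x + y) / 2"
      show False
      proof (rule supersolution_no_two_zeros[OF xy(3), of F F1 Q])
        fix z assume z: "z \<in> {x..y}"
        hence z': "z \<in> {u..<v}" using xy by auto
        show "(F has_real_derivative F1 z) (at z)" "(F1 has_real_derivative - Q z * F z) (at z)"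
          using F z' by auto
        show "((\<lambda>z. cos (\<omega> * (z - m))) has_real_derivative - (\<omega> * sin (\<omega> * (z - m)))) (at z)"
          "((\<lambda>z. - (\<omega> * sin (\<omega> * (z - m)))) has_real_derivative - (\<omega>\<^sup>2 * cos (\<omega> * (z - m)))) (at z)"
          by (auto intro!: derivative_eq_intros simp: power2_eq_square)
        have "\<bar>z - m\<bar> \<le> (y - x) / 2" using z by (auto simp: m_def abs_le_iff field_simps)
        hence "\<omega> * \<bar>z - m\<bar> \<le> \<omega> * ((y - x) / 2)" using w by (intro mult_left_mono) auto
        also have "\<dots> < pi / 2" using less by simp
        finally have "\<bar>\<omega> * (z - m)\<bar> < pi / 2" using w by (simp add: abs_mult)
        thus pos: "cos (\<omega> * (z - m)) > 0" by (intro cos_gt_zero_pi) auto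
        show "- (\<omega>\<^sup>2 * cos (\<omega> * (z - m))) + Q z * cos (\<omega> * (z - m)) \<le> 0"
          using mult_right_mono[OF Q[OF z'], of "cos (\<omega> * (z - m))"] pos by simp
      qed (use xy in \<open>auto intro: rev_finite_subset[OF fin]\<close>)
    qed
  qed (use uv w in auto)
  thus ?thesis by simp
qed

lemma count_zeros_ge:
  fixes F F1 Q :: "real \<Rightarrow> real"
  assumes w: "\<omega> > 0" and fin: "finite {x \<in> {u..<v}. F x = 0}"
    and F: "\<And>x. x \<in> {u..v} \<Longrightarrow> (F has_real_derivative F1 x) (at x)"
           "\<And>x. x \<in> {u..v} \<Longrightarrow> (F1 has_real_derivative - Q x * F x) (at x)"
    and Q: "\<And>x. x \<in> {u..v} \<Longrightarrow> Q x \<ge> \<omega>\<^sup>2"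
  shows "real (card {x \<in> {u..<v}. F x = 0}) \<ge> (v - u) * \<omega> / pi - 1"
proof -
  have "real (card {x \<in> {u..<v}. F x = 0}) \<ge> (v - u) / (pi / \<omega>) - 1"
  proof (rule card_dense_ge[OF fin])
    fix s assume s: "u \<le> s" "s + pi / \<omega> \<le> v"
    have "\<exists>x\<in>{s..<s + pi / \<omega>}. F x = 0"
      by (rule sturm_zero_exists[OF w, of _ F F1 Q]) (use s F Q in auto)
    then obtain x where "s \<le> x" "x < s + pi / \<omega>" "F x = 0" by auto
    with s show "\<exists>x\<in>{x \<in> {u..<v}. F x = 0}. s \<le> x \<and> x < s + pi / \<omega>"
      by (intro bexI[of _ x]) auto
  qed (use w in auto)
  thus ?thesis by simp
qed

text \<open>Singular potentials: \<open>Q\<close> may exceed \<open>\<omega>\<^sup>2\<close> by any amount \<open>Q\<^sub>0\<close> for which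
  \<open>G'' + Q\<^sub>0 G = 0\<close> has a positive monotone solution. Multiplying that solution by a cosine that
  decreases where it increases, and conversely, gives a supersolution.\<close>

lemma count_zeros_monotone_weight_le:
  fixes F F1 Q G G1 Q0 :: "real \<Rightarrow> real"
  assumes st: "s \<le> t" and w: "\<omega> > 0"
    and fin: "finite {x \<in> {s..<t} \<inter> {p<..<q}. F x = 0}"
    and F: "\<And>x. x \<in> {p<..<q} \<Longrightarrow> (F has_real_derivative F1 x) (at x)"
           "\<And>x. x \<in> {p<..<q} \<Longrightarrow> (F1 has_real_derivative - Q x * F x) (at x)"
    and G: "\<And>x. x \<in> {p<..<q} \<Longrightarrow> (G has_real_derivative G1 x) (at x)"
           "\<And>x. x \<in> {p<..<q} \<Longrightarrow> (G1 has_real_derivative - Q0 x * G x) (at x)"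
    and Gpos: "\<And>x. x \<in> {p<..<q} \<Longrightarrow> G x > 0"
    and sgn: "(\<forall>x\<in>{p<..<q}. G1 x > 0) \<or> (\<forall>x\<in>{p<..<q}. G1 x < 0)"
    and Q: "\<And>x. x \<in> {p<..<q} \<Longrightarrow> Q x \<le> Q0 x + \<omega>\<^sup>2"
  shows "real (card {x \<in> {s..<t} \<inter> {p<..<q}. F x = 0}) \<le> (t - s) * (2 * \<omega>) / pi + 1"
proof -
  have "real (card {x \<in> {s..<t} \<inter> {p<..<q}. F x = 0}) \<le> (t - s) / (pi / (2 * \<omega>)) + 1"
  proof (rule card_separated_le(2))
    fix x y assume xy: "x \<in> {x \<in> {s..<t} \<inter> {p<..<q}. F x = 0}"
      "y \<in> {x \<in> {s..<t} \<inter> {p<..<q}. F x = 0}" "x < y"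
    show "y - x \<ge> pi / (2 * \<omega>)"
    proof (rule ccontr)
      assume "\<not> ?thesis"
      hence less: "\<omega> * (y - x) < pi / 2" using w by (simp add: field_simps)
      \<comment> \<open>The cosine is centred at the end where G is smallest, which makes the cross
        term -2\<omega> G' sin(\<omega>(z - m)) nonpositive. It must then stay positive over the
        full length y - x on one side of m, hence the gap pi/(2\<omega>) instead of
        pi/\<omega>.\<close>
      define m where "m = (if \<forall>x\<in>{p<..<q}. G1 x > 0 then x else y)"
      show False
      proof (rule supersolution_no_two_zeros[OF xy(3), of F F1 Q])
        fix z assume z: "z \<in> {x..y}"
        hence z': "z \<in> {p<..<q}" using xy by auto
        show "(F has_real_derivative F1 z) (at z)" "(F1 has_real_derivative - Q z * F z) (at z)"
          using F z' by auto
        show "((\<lambda>z. G z * cos (\<omega> * (z - m))) has_real_derivative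
            G1 z * cos (\<omega> * (z - m)) - G z * (\<omega> * sin (\<omega> * (z - m)))) (at z)"
          "((\<lambda>z. G1 z * cos (\<omega> * (z - m)) - G z * (\<omega> * sin (\<omega> * (z - m)))) has_real_derivative
            - (Q0 z + \<omega>\<^sup>2) * (G z * cos (\<omega> * (z - m))) - 2 * \<omega> * (G1 z * sin (\<omega> * (z - m)))) (at z)"
          using z' by (auto intro!: derivative_eq_intros G simp: power2_eq_square algebra_simps)
        have "\<bar>z - m\<bar> \<le> y - x" using z by (auto simp: m_def)
        hence "\<omega> * \<bar>z - m\<bar> \<le> \<omega> * (y - x)" using w by (intro mult_left_mono) auto
        also note less
        finally have b: "\<bar>\<omega> * (z - m)\<bar> < pi / 2" using w by (simp add: abs_mult)
        hence cpos: "cos (\<omega> * (z - m)) > 0" by (intro cos_gt_zero_pi) auto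
        thus pos: "G z * cos (\<omega> * (z - m)) > 0" using Gpos[OF z'] by simp
        have "G1 z * sin (\<omega> * (z - m)) \<ge> 0"
        proof (cases "\<forall>x\<in>{p<..<q}. G1 x > 0")
          case True
          hence "\<omega> * (z - m) \<ge> 0" using z w by (simp add: m_def)
          hence "sin (\<omega> * (z - m)) \<ge> 0" using b by (intro sin_ge_zero) auto
          thus ?thesis using True z' by (intro mult_nonneg_nonneg) (auto intro: less_imp_le)
        next
          case False
          hence neg: "G1 z < 0" using sgn z' by auto
          have "\<omega> * (m - z) \<ge> 0" unfolding m_def if_not_P[OF False] using z w by simp
          moreover have "\<omega> * (m - z) = - (\<omega> * (z - m))" by (simp add: algebra_simps)
          ultimately have "sin (\<omega> * (m - z)) \<ge> 0" using b by (intro sin_ge_zero) auto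
          hence "- sin (\<omega> * (z - m)) \<ge> 0"
            unfolding \<open>\<omega> * (m - z) = - (\<omega> * (z - m))\<close> by simp
          thus ?thesis using neg by (simp add: mult_nonpos_nonpos)
        qed
        hence "2 * \<omega> * (G1 z * sin (\<omega> * (z - m))) \<ge> 0" using w by simp
        moreover have "Q z * (G z * cos (\<omega> * (z - m))) \<le> (Q0 z + \<omega>\<^sup>2) * (G z * cos (\<omega> * (z - m)))"
          using Q[OF z'] pos by (intro mult_right_mono) auto
        ultimately show "- (Q0 z + \<omega>\<^sup>2) * (G z * cos (\<omega> * (z - m)))
            - 2 * \<omega> * (G1 z * sin (\<omega> * (z - m))) + Q z * (G z * cos (\<omega> * (z - m))) \<le> 0"
          by (simp only: mult_minus_left)
      qed (use xy in \<open>auto intro: rev_finite_subset[OF fin]\<close>)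
    qed
  qed (use st w in auto)
  thus ?thesis by simp
qed

text \<open>The cells are cut at zeros of sin(4kt). Zeros of sin(2kt) are the singular points of Q;
  those of cos(2kt) are the critical points of sqrt |sin 2kt|, which is therefore monotone on each
  cell.\<close>

lemma sin_cos_nonzero_quarter:
  assumes "k > 0" "t \<in> {real m * pi / (4 * k)<..<real (m + 1) * pi / (4 * k)}"
  shows "sin (k * t) \<noteq> 0" "cos (k * t) \<noteq> 0" "(cos (k * t))\<^sup>2 \<noteq> (sin (k * t))\<^sup>2"
proof -
  have t: "real m * pi < 4 * (k * t)" "4 * (k * t) < real (m + 1) * pi"
    using assms by (auto simp: field_simps)
  have "sin (4 * (k * t)) \<noteq> 0"
  proof
    assume "sin (4 * (k * t)) = 0"
    then obtain i :: int where i: "4 * (k * t) = of_int i * pi" by (auto simp: sin_zero_iff_int2)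
    have "real_of_int (int m) < of_int i" "real_of_int i < of_int (int m + 1)"
      using t unfolding i by (auto simp: mult_less_cancel_right)
    hence "int m < i" "i < int m + 1" unfolding of_int_less_iff .
    thus False by simp
  qed
  moreover have "sin (4 * (k * t)) = 4 * sin (k * t) * cos (k * t) * ((cos (k * t))\<^sup>2 - (sin (k * t))\<^sup>2)"
    using sin_double[of "2 * (k * t)"] by (simp add: sin_double cos_double)
  ultimately show "sin (k * t) \<noteq> 0" "cos (k * t) \<noteq> 0" "(cos (k * t))\<^sup>2 \<noteq> (sin (k * t))\<^sup>2"
    by auto
qed

text \<open>This weight is sqrt |sin 2kt| up to a constant factor. The exponent \<rho> = 1/2
  minimizes \<rho>(\<rho> - 1), so its potential carries the largest inverse-square coefficient,
  1/4, at both kinds of singular points.\<close>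

lemma trig_weight_half:
  assumes "sin (k * t) \<noteq> 0" "cos (k * t) \<noteq> 0"
  shows "((\<lambda>t. trig_weight (1/2) (1/2) k t * trig_logderiv (1/2) (1/2) k t) has_real_derivative
    - (k\<^sup>2 * (1 + 1 / 4 / (sin (k * t))\<^sup>2 + 1 / 4 / (cos (k * t))\<^sup>2)) * trig_weight (1/2) (1/2) k t) (at t)"
proof -
  define s c l where "s = sin (k * t)" "c = cos (k * t)" "l = trig_logderiv (1/2) (1/2) k t"
  note d = this
  have nz: "s \<noteq> 0" "c \<noteq> 0" using assms by (auto simp: d)
  have s2: "s\<^sup>2 = 1 - c\<^sup>2" by (simp add: d sin_squared_eq)
  have ls: "l = k * (1 / 2 * c / s - 1 / 2 * s / c)" by (simp add: d trig_logderiv_def)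
  have l2: "l\<^sup>2 = k\<^sup>2 / 4 * ((1 / s\<^sup>2 - 1) - 2 + (1 / c\<^sup>2 - 1))"
  proof -
    have "l\<^sup>2 = k\<^sup>2 / 4 * (c\<^sup>2 / s\<^sup>2 - 2 + s\<^sup>2 / c\<^sup>2)"
      using nz by (simp add: ls power2_eq_square field_simps)
    also have "c\<^sup>2 / s\<^sup>2 = 1 / s\<^sup>2 - 1" using nz s2 by (simp add: field_simps)
    also have "s\<^sup>2 / c\<^sup>2 = 1 / c\<^sup>2 - 1" using nz s2 by (simp add: field_simps)
    finally show ?thesis .
  qed
  have "((\<lambda>t. trig_weight (1/2) (1/2) k t * trig_logderiv (1/2) (1/2) k t) has_real_derivative
    trig_weight (1/2) (1/2) k t * l * l
      + - k\<^sup>2 * (1/2 / s\<^sup>2 + 1/2 / c\<^sup>2) * trig_weight (1/2) (1/2) k t) (at t)"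
    unfolding d by (rule DERIV_mult has_derivative_trig_weight has_derivative_trig_logderiv assms)+
  also have "trig_weight (1/2) (1/2) k t * l * l
      + - k\<^sup>2 * (1/2 / s\<^sup>2 + 1/2 / c\<^sup>2) * trig_weight (1/2) (1/2) k t
      = (l\<^sup>2 - k\<^sup>2 * (1/2 * (1 / s\<^sup>2) + 1/2 * (1 / c\<^sup>2))) * trig_weight (1/2) (1/2) k t"
    by (simp add: algebra_simps power2_eq_square)
  also have "l\<^sup>2 - k\<^sup>2 * (1/2 * (1 / s\<^sup>2) + 1/2 * (1 / c\<^sup>2))
      = - (k\<^sup>2 * (1 + 1 / 4 / s\<^sup>2 + 1 / 4 / c\<^sup>2))"
    unfolding l2 by (simp add: algebra_simps)
  finally show ?thesis by (simp only: d)
qed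

lemma sieved_B_zero_iff_liouville_F:
  assumes "k \<ge> 2" "\<gamma> > -1" "sin (real k * t) \<noteq> 0"
  shows "poly (sieved_B \<alpha> \<gamma> k (Suc n * k - 1)) (cos t) = 0 \<longleftrightarrow> liouville_F \<alpha> \<gamma> (real k) n t = 0"
proof -
  have "poly (cheb_U (k - 1)) (cos t) \<noteq> 0"
    using cheb_U_cos[of t "k - 1"] assms by auto
  thus ?thesis
    using sieved_B_factor[OF assms(1,2), of \<alpha> n "cos t"] trig_weight_pos[of "\<alpha> + 1" "\<gamma> / 2" k t]
    by (simp add: liouville_F_def cheb_T_cos)
qed

lemma finite_zeros_cos:
  fixes p :: "real poly"
  assumes "p \<noteq> 0" "A \<subseteq> {0..pi}"
  shows "finite {t \<in> A. poly p (cos t) = 0}"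
proof (rule finite_imageD)
  show "finite (cos ` {t \<in> A. poly p (cos t) = 0})"
    by (rule finite_subset[OF _ poly_roots_finite[OF assms(1)]]) auto
  show "inj_on cos {t \<in> A. poly p (cos t) = 0}"
    using assms(2) by (intro inj_onI) (auto intro!: cos_inj_pi)
qed

lemma quarter_cover:
  assumes "k > 0" "0 \<le> t" "t < pi"
  obtains m where "m < 4 * k" "t = real m * pi / (4 * real k)
      \<or> t \<in> {real m * pi / (4 * real k)<..<real (m + 1) * pi / (4 * real k)}"
proof -
  define m where "m = nat \<lfloor>4 * real k * t / pi\<rfloor>"
  have nn: "0 \<le> 4 * real k * t / pi" using assms by simp
  have "real m \<le> 4 * real k * t / pi" "4 * real k * t / pi < real (m + 1)"
    using nn by (auto simp: m_def) linarith
  hence *: "real m * pi / (4 * real k) \<le> t" "t < real (m + 1) * pi / (4 * real k)"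
    using assms by (auto simp: field_simps)
  have "real m * pi / (4 * real k) < pi" using * assms by linarith
  hence "real m < real (4 * k)" using assms by (simp add: field_simps)
  hence "m < 4 * k" by linarith
  with * show ?thesis by (intro that[of m]) auto
qed

text \<open>A crude bound, but uniform in the parameters and valid across the singular points: each
  of the 4k cells is treated by comparison with sqrt |sin 2kt|, and all 4k+1 cell ends are counted
  as possible zeros.\<close>

lemma sieved_zeros_lipschitz:
  assumes k: "k \<ge> 2" and \<alpha>: "\<alpha> > -1/2" and \<gamma>: "\<gamma> > -1" and n: "odd n"
    and st: "0 \<le> s" "s \<le> t" "t \<le> pi"
  defines "\<omega> \<equiv> real k * (real n + \<alpha> + 1 + \<gamma> / 2)"
  shows "real (card {x \<in> {s..<t}. poly (sieved_B \<alpha> \<gamma> k (Suc n * k - 1)) (cos x) = 0})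
     \<le> 4 * real k * ((t - s) * (2 * \<omega>) / pi + 1) + (4 * real k + 1)"
proof -
  define Z where "Z A = {x \<in> A. poly (sieved_B \<alpha> \<gamma> k (Suc n * k - 1)) (cos x) = 0}" for A
  define J where "J m = {real m * pi / (4 * real k)<..<real (m + 1) * pi / (4 * real k)}" for m
  define P where "P = (\<lambda>m. real m * pi / (4 * real k)) ` {..4 * k}"
  have k0: "real k > 0" using k by simp
  have "real n \<ge> 1" using odd_pos[OF n] by simp
  hence w: "\<omega> > 0" unfolding \<omega>_def using k0 \<alpha> \<gamma> by (intro mult_pos_pos) linarith+
  have Jsub: "J m \<subseteq> {0..pi}" if "m < 4 * k" for m
  proof
    fix x assume "x \<in> J m"
    hence x: "real m * pi / (4 * real k) < x" "x < real (m + 1) * pi / (4 * real k)" by (auto simp: J_def)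
    have "real (m + 1) * pi / (4 * real k) \<le> real (4 * k) * pi / (4 * real k)"
      using that k0 by (intro divide_right_mono mult_right_mono) auto
    also have "\<dots> = pi" using k0 by simp
    finally have "x \<le> pi" using x by linarith
    moreover have "0 \<le> real m * pi / (4 * real k)" by simp
    hence "0 \<le> x" using x(1) by linarith
    ultimately show "x \<in> {0..pi}" by simp
  qed
  have piece: "real (card (Z ({s..<t} \<inter> J m))) \<le> (t - s) * (2 * \<omega>) / pi + 1" if m: "m < 4 * k" for m
  proof -
    have nz: "sin (real k * x) \<noteq> 0" "cos (real k * x) \<noteq> 0" "(cos (real k * x))\<^sup>2 \<noteq> (sin (real k * x))\<^sup>2"
      if "x \<in> J m" for x using sin_cos_nonzero_quarter[OF k0, of x m] that by (auto simp: J_def)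
    have eq: "Z ({s..<t} \<inter> J m) = {x \<in> {s..<t} \<inter> J m. liouville_F \<alpha> \<gamma> (real k) n x = 0}"
      using sieved_B_zero_iff_liouville_F[OF k \<gamma> nz(1)] by (auto simp: Z_def)
    show ?thesis unfolding eq unfolding J_def
    proof (rule count_zeros_monotone_weight_le[OF st(2) w,
          where ?F1.0 = "liouville_F1 \<alpha> \<gamma> k n" and Q = "liouville_Q \<alpha> \<gamma> k n" and G = "trig_weight (1/2) (1/2) k"
            and ?G1.0 = "\<lambda>t. trig_weight (1/2) (1/2) k t * trig_logderiv (1/2) (1/2) k t"
            and ?Q0.0 = "\<lambda>t. (real k)\<^sup>2 * (1 + 1 / 4 / (sin (k * t))\<^sup>2 + 1 / 4 / (cos (k * t))\<^sup>2)"], fold J_def)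
      show "finite {x \<in> {s..<t} \<inter> J m. liouville_F \<alpha> \<gamma> (real k) n x = 0}"
        unfolding eq[symmetric] Z_def
        using finite_zeros_cos[OF sieved_B_nonzero[OF k \<alpha> \<gamma>]] Jsub[OF m] by blast
      let ?l = "trig_logderiv (1/2) (1/2) (real k)"
      have "(\<forall>x\<in>J m. ?l x > 0) \<or> (\<forall>x\<in>J m. ?l x < 0)"
      proof (rule nonzero_constant_sign)
        show "is_interval (J m)" by (simp add: J_def is_interval_1)
        show "continuous_on (J m) ?l"
          using DERIV_isCont[OF has_derivative_trig_logderiv[OF nz(1,2)]]
          by (intro continuous_at_imp_continuous_on) auto
        fix x assume x: "x \<in> J m"
        thus "?l x \<noteq> 0" using nz[OF x] k0
          by (auto simp: trig_logderiv_def field_simps power2_eq_square)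
      qed
      thus "(\<forall>x\<in>J m. trig_weight (1/2) (1/2) k x * ?l x > 0) \<or>
         (\<forall>x\<in>J m. trig_weight (1/2) (1/2) k x * ?l x < 0)"
        using trig_weight_pos[of "1/2" "1/2" k]
        by (simp add: zero_less_mult_iff mult_less_0_iff order_less_not_sym)
      fix x assume x: "x \<in> J m"
      note nz = nz[OF x]
      show "(liouville_F \<alpha> \<gamma> k n has_real_derivative liouville_F1 \<alpha> \<gamma> k n x) (at x)"
        by (rule has_derivative_liouville_F[OF nz(1,2)])
      show "(liouville_F1 \<alpha> \<gamma> k n has_real_derivative - liouville_Q \<alpha> \<gamma> k n x * liouville_F \<alpha> \<gamma> k n x) (at x)"
        by (rule has_derivative_liouville_F1[OF nz(1,2) \<gamma> n])
      show "trig_weight (1/2) (1/2) k x > 0" by (rule trig_weight_pos)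
      show "(trig_weight (1/2) (1/2) k has_real_derivative
          trig_weight (1/2) (1/2) k x * ?l x) (at x)"
        by (rule has_derivative_trig_weight[OF nz(1,2)])
      show "((\<lambda>t. trig_weight (1/2) (1/2) k t * ?l t) has_real_derivative
        - ((real k)\<^sup>2 * (1 + 1 / 4 / (sin (k * x))\<^sup>2 + 1 / 4 / (cos (k * x))\<^sup>2)) * trig_weight (1/2) (1/2) k x) (at x)"
        using trig_weight_half[OF nz(1,2)] .
      \<comment> \<open>Since \<alpha>(\<alpha>+1) = (\<alpha> + 1/2)^2 - 1/4 and
        \<gamma>(\<gamma>+2)/4 = ((\<gamma>+1)^2 - 1)/4, the poles of Q are at most the critical
        ones.\<close>
      have "- (1 / 4) \<le> \<alpha> * (\<alpha> + 1)"
        using zero_le_power2[of "\<alpha> + 1/2"] by (simp add: power2_eq_square algebra_simps)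
      hence 1: "- (1 / 4) / (sin (k * x))\<^sup>2 \<le> \<alpha> * (\<alpha> + 1) / (sin (k * x))\<^sup>2"
        by (intro divide_right_mono) auto
      have "- (1 / 4) \<le> \<gamma> * (\<gamma> + 2) / 4"
        using zero_le_power2[of "\<gamma> + 1"] by (simp add: power2_eq_square algebra_simps)
      hence 2: "- (1 / 4) / (cos (k * x))\<^sup>2 \<le> \<gamma> * (\<gamma> + 2) / 4 / (cos (k * x))\<^sup>2"
        by (intro divide_right_mono) auto
      have "liouville_Q \<alpha> \<gamma> k n x \<le> (real k)\<^sup>2 * ((real n + \<alpha> + 1 + \<gamma> / 2)\<^sup>2
            + 1 / 4 / (sin (k * x))\<^sup>2 + 1 / 4 / (cos (k * x))\<^sup>2)"
        unfolding liouville_Q_def using 1 2 by (intro mult_left_mono) auto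
      also have "\<dots> \<le> (real k)\<^sup>2 * (1 + 1 / 4 / (sin (k * x))\<^sup>2 + 1 / 4 / (cos (k * x))\<^sup>2) + \<omega>\<^sup>2"
        unfolding \<omega>_def power_mult_distrib by (simp add: algebra_simps)
      finally show "liouville_Q \<alpha> \<gamma> k n x
          \<le> (real k)\<^sup>2 * (1 + 1 / 4 / (sin (k * x))\<^sup>2 + 1 / 4 / (cos (k * x))\<^sup>2) + \<omega>\<^sup>2" .
    qed
  qed
  have fin: "finite (Z A)" if "A \<subseteq> {0..pi}" for A
    unfolding Z_def using finite_zeros_cos[OF sieved_B_nonzero[OF k \<alpha> \<gamma>]] that by blast
  have "Z {s..<t} \<subseteq> (\<Union>m<4 * k. Z ({s..<t} \<inter> J m)) \<union> P"
  proof
    fix x assume x: "x \<in> Z {s..<t}"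
    hence "0 \<le> x" "x < pi" using st by (auto simp: Z_def)
    then obtain m where "m < 4 * k" "x = real m * pi / (4 * real k) \<or> x \<in> J m"
      using quarter_cover[of k x] k by (auto simp: J_def)
    thus "x \<in> (\<Union>m<4 * k. Z ({s..<t} \<inter> J m)) \<union> P" using x by (auto simp: P_def Z_def)
  qed
  hence "card (Z {s..<t}) \<le> card ((\<Union>m<4 * k. Z ({s..<t} \<inter> J m)) \<union> P)"
    using st by (intro card_mono) (auto simp: P_def intro!: fin)
  also have "\<dots> \<le> card (\<Union>m<4 * k. Z ({s..<t} \<inter> J m)) + card P" by (rule card_Un_le)
  also have "\<dots> \<le> (\<Sum>m<4 * k. card (Z ({s..<t} \<inter> J m))) + (4 * k + 1)"
  proof (rule add_mono)
    show "card P \<le> 4 * k + 1" using card_image_le[of "{..4 * k}"] by (auto simp: P_def)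
  qed (rule card_UN_le, simp)
  finally have "real (card (Z {s..<t})) \<le> real ((\<Sum>m<4 * k. card (Z ({s..<t} \<inter> J m))) + (4 * k + 1))"
    by (simp only: of_nat_le_iff)
  also have "\<dots> = (\<Sum>m<4 * k. real (card (Z ({s..<t} \<inter> J m)))) + (4 * real k + 1)" by simp
  also have "\<dots> \<le> (\<Sum>m<4 * k. (t - s) * (2 * \<omega>) / pi + 1) + (4 * real k + 1)"
    using piece by (intro add_right_mono sum_mono) auto
  also have "\<dots> = 4 * real k * ((t - s) * (2 * \<omega>) / pi + 1) + (4 * real k + 1)" by simp
  finally show ?thesis by (simp add: Z_def)
qed

section \<open>From local densities to limits\<close>

definition ev_bounded :: "(nat \<Rightarrow> real) \<Rightarrow> bool" where
  "ev_bounded X \<longleftrightarrow> (\<exists>B. \<forall>\<^sub>F l in sequentially. \<bar>X l\<bar> \<le> B)"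

text \<open>The limit superior as a real number; it is meaningful for eventually bounded sequences,
  and the lower limit is obtained as the negative of \<open>upper_lim\<close> of the negated
  sequence.\<close>

definition upper_lim :: "(nat \<Rightarrow> real) \<Rightarrow> real" where
  "upper_lim X = Inf {r. \<forall>\<^sub>F l in sequentially. X l \<le> r}"

lemma ev_bounded_set:
  assumes "ev_bounded X"
  shows "{r. \<forall>\<^sub>F l in sequentially. X l \<le> r} \<noteq> {}" "bdd_below {r. \<forall>\<^sub>F l in sequentially. X l \<le> r}"
proof -
  obtain B where B: "\<forall>\<^sub>F l in sequentially. \<bar>X l\<bar> \<le> B" using assms by (auto simp: ev_bounded_def)
  hence "\<forall>\<^sub>F l in sequentially. X l \<le> B" by eventually_elim auto
  thus "{r. \<forall>\<^sub>F l in sequentially. X l \<le> r} \<noteq> {}" by blast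
  show "bdd_below {r. \<forall>\<^sub>F l in sequentially. X l \<le> r}"
  proof (rule bdd_belowI)
    fix r assume "r \<in> {r. \<forall>\<^sub>F l in sequentially. X l \<le> r}"
    hence "\<forall>\<^sub>F l in sequentially. X l \<le> r" by simp
    with B have "\<forall>\<^sub>F l in sequentially. - B \<le> r" by eventually_elim auto
    thus "- B \<le> r" by simp
  qed
qed

lemma upper_lim_mono:
  assumes "ev_bounded X" "ev_bounded Y" "\<forall>\<^sub>F l in sequentially. X l \<le> Y l + d"
  shows "upper_lim X \<le> upper_lim Y + d"
proof -
  have "upper_lim X - d \<le> upper_lim Y"
    unfolding upper_lim_def[of Y]
  proof (rule cInf_greatest[OF ev_bounded_set(1)[OF assms(2)]])
    fix r assume "r \<in> {r. \<forall>\<^sub>F l in sequentially. Y l \<le> r}"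
    hence "\<forall>\<^sub>F l in sequentially. Y l \<le> r" by simp
    with assms(3) have "\<forall>\<^sub>F l in sequentially. X l \<le> r + d" by eventually_elim auto
    hence "upper_lim X \<le> r + d"
      unfolding upper_lim_def by (intro cInf_lower ev_bounded_set(2)[OF assms(1)]) simp
    thus "upper_lim X - d \<le> r" by simp
  qed
  thus ?thesis by simp
qed

lemma upper_lim_zero: "upper_lim (\<lambda>_. 0) = 0"
proof -
  have "{r::real. 0 \<le> r} = {0..}" by auto
  thus ?thesis by (simp add: upper_lim_def)
qed

lemma ev_less_upper_lim:
  assumes "ev_bounded X" "upper_lim X < r"
  shows "\<forall>\<^sub>F l in sequentially. X l < r"
proof -
  obtain r' where "r' < r" "\<forall>\<^sub>F l in sequentially. X l \<le> r'"
    using cInf_lessD[OF ev_bounded_set(1)[OF assms(1)] assms(2)[unfolded upper_lim_def]] by auto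
  thus ?thesis by (auto elim: eventually_mono)
qed

lemma ev_bounded_uminus: "ev_bounded X \<Longrightarrow> ev_bounded (\<lambda>l. - X l)"
  by (simp add: ev_bounded_def)

text \<open>\<open>\<Lambda>\<close> is instantiated with the upper and with the lower limit. Each turns the local density
  estimate into a derivative, so both limits of \<open>M\<close> are primitives of the same function.\<close>

lemma density_functional:
  fixes M :: "nat \<Rightarrow> real \<Rightarrow> real" and \<Lambda> :: "(nat \<Rightarrow> real) \<Rightarrow> real"
  assumes \<Lambda>: "\<And>X Y d. ev_bounded X \<Longrightarrow> ev_bounded Y \<Longrightarrow>
      \<forall>\<^sub>F l in sequentially. X l \<le> Y l + d \<Longrightarrow> \<Lambda> X \<le> \<Lambda> Y + d"
    and \<Lambda>0: "\<Lambda> (\<lambda>_. 0) = 0"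
    and bnd: "\<And>t. 0 \<le> t \<Longrightarrow> t \<le> pi \<Longrightarrow> ev_bounded (\<lambda>l. M l t)"
    and finS: "finite Sing"
    and lip: "\<And>s t. 0 \<le> s \<Longrightarrow> s < t \<Longrightarrow> t \<le> pi \<Longrightarrow>
      \<forall>\<^sub>F l in sequentially. 0 \<le> M l s - M l t \<and> M l s - M l t \<le> C * (t - s)"
    and loc: "\<And>t0 \<epsilon>. 0 < t0 \<Longrightarrow> t0 < pi \<Longrightarrow> t0 \<notin> Sing \<Longrightarrow> \<epsilon> > 0 \<Longrightarrow>
      \<exists>\<delta>>0. \<forall>s t. t0 - \<delta> < s \<longrightarrow> s < t \<longrightarrow> t < t0 + \<delta> \<longrightarrow>
        (\<forall>\<^sub>F l in sequentially. \<bar>M l s - M l t - h t0 * (t - s)\<bar> \<le> \<epsilon> * (t - s))"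
    and zero: "\<And>l. M l pi = 0"
    and H: "\<And>x. -1 < x \<Longrightarrow> x < 1 \<Longrightarrow> arccos x \<notin> Sing \<Longrightarrow> H x = h (arccos x) / sqrt (1 - x\<^sup>2)"
    and y: "y \<in> {-1..1}"
  shows "(H has_integral \<Lambda> (\<lambda>l. M l (arccos y))) {-1..y}"
proof -
  define U where "U t = \<Lambda> (\<lambda>l. M l t)" for t
  have Ulip: "\<bar>U s - U t\<bar> \<le> C * (t - s)" if "0 \<le> s" "s < t" "t \<le> pi" for s t
  proof -
    note ev = lip[OF that]
    have "\<forall>\<^sub>F l in sequentially. M l s \<le> M l t + C * (t - s)"
      "\<forall>\<^sub>F l in sequentially. M l t \<le> M l s + 0"
      using ev by (auto elim: eventually_mono)
    from this[THEN \<Lambda>[rotated 2]] bnd that have "U s \<le> U t + C * (t - s)" "U t \<le> U s + 0"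
      unfolding U_def by auto
    thus ?thesis by linarith
  qed
  have C: "C \<ge> 0"
  proof -
    have "0 \<le> \<bar>U 0 - U pi\<bar>" by simp
    also have "\<dots> \<le> C * (pi - 0)" by (rule Ulip) auto
    finally show ?thesis using pi_gt_zero by (auto simp: zero_le_mult_iff)
  qed
  have Ucont: "continuous_on {0..pi} U"
  proof (rule lipschitz_on_continuous_on[of C], rule lipschitz_onI[OF _ C])
    fix s t assume "s \<in> {0..pi}" "t \<in> {0..pi}"
    thus "dist (U s) (U t) \<le> C * dist s t"
      using Ulip[of s t] Ulip[of t s] by (cases s t rule: linorder_cases) (auto simp: dist_real_def)
  qed
  have Uloc: "\<exists>\<delta>>0. \<forall>s t. t0 - \<delta> < s \<longrightarrow> s < t \<longrightarrow> t < t0 + \<delta> \<longrightarrow> \<bar>U s - U t - h t0 * (t - s)\<bar> \<le> \<epsilon> * (t - s)"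
    if t0: "0 < t0" "t0 < pi" "t0 \<notin> Sing" "\<epsilon> > 0" for t0 \<epsilon>
  proof -
    obtain \<delta> where \<delta>: "\<delta> > 0" "\<And>s t. t0 - \<delta> < s \<Longrightarrow> s < t \<Longrightarrow> t < t0 + \<delta> \<Longrightarrow>
        \<forall>\<^sub>F l in sequentially. \<bar>M l s - M l t - h t0 * (t - s)\<bar> \<le> \<epsilon> * (t - s)"
      using loc[OF t0] by auto
    define \<delta>' where "\<delta>' = min \<delta> (min t0 (pi - t0))"
    have "\<bar>U s - U t - h t0 * (t - s)\<bar> \<le> \<epsilon> * (t - s)"
      if st: "t0 - \<delta>' < s" "s < t" "t < t0 + \<delta>'" for s t
    proof -
      have "t0 - \<delta> < s" "t < t0 + \<delta>" and dom: "0 \<le> s" "s \<le> pi" "0 \<le> t" "t \<le> pi"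
        using st by (auto simp: \<delta>'_def)
      note ev = \<delta>(2)[OF this(1) st(2) this(2)]
      have "\<forall>\<^sub>F l in sequentially. M l s \<le> M l t + (h t0 * (t - s) + \<epsilon> * (t - s))"
        "\<forall>\<^sub>F l in sequentially. M l t \<le> M l s + (\<epsilon> * (t - s) - h t0 * (t - s))"
        using ev by (auto elim!: eventually_mono)
      from this[THEN \<Lambda>[rotated 2]] bnd dom
      have "U s \<le> U t + (h t0 * (t - s) + \<epsilon> * (t - s))" "U t \<le> U s + (\<epsilon> * (t - s) - h t0 * (t - s))"
        unfolding U_def by auto
      thus ?thesis by linarith
    qed
    moreover have "\<delta>' > 0" using \<delta>(1) t0 by (simp add: \<delta>'_def)
    ultimately show ?thesis by blast
  qed
  \<comment> \<open>By \<open>lip\<close> the counts decrease in t, hence the minus sign; it cancels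
    against the derivative -1/sqrt(1 - x^2) of arccos.\<close>
  have Uderiv: "(U has_real_derivative - h t0) (at t0)" if t0: "0 < t0" "t0 < pi" "t0 \<notin> Sing" for t0
    unfolding has_field_derivative_iff
  proof (rule tendstoI)
    fix e :: real assume e: "e > 0"
    obtain \<delta> where \<delta>: "\<delta> > 0" "\<And>s t. t0 - \<delta> < s \<Longrightarrow> s < t \<Longrightarrow> t < t0 + \<delta> \<Longrightarrow>
        \<bar>U s - U t - h t0 * (t - s)\<bar> \<le> e / 2 * (t - s)"
      using Uloc[OF t0, of "e / 2"] e by auto
    have "dist ((U z - U t0) / (z - t0)) (- h t0) < e" if z: "z \<noteq> t0" "dist z t0 < \<delta>" for z
    proof -
      have "\<bar>U z - U t0 + h t0 * (z - t0)\<bar> \<le> e / 2 * \<bar>z - t0\<bar>"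
      proof (cases "z < t0")
        case True
        thus ?thesis using \<delta>(2)[of z t0] z \<delta>(1) by (auto simp: dist_real_def algebra_simps)
      next
        case False
        have "\<bar>U z - U t0 + h t0 * (z - t0)\<bar> = \<bar>U t0 - U z - h t0 * (z - t0)\<bar>" by argo
        also have "\<dots> \<le> e / 2 * (z - t0)"
          using False \<delta>(2)[of t0 z] z \<delta>(1) by (auto simp: dist_real_def)
        finally show ?thesis using False by simp
      qed
      also have "\<dots> < e * \<bar>z - t0\<bar>" using e z by simp
      also have "\<bar>U z - U t0 + h t0 * (z - t0)\<bar> = \<bar>(U z - U t0) / (z - t0) + h t0\<bar> * \<bar>z - t0\<bar>"
        using z by (simp add: field_simps flip: abs_mult)
      finally show ?thesis using z by (simp add: dist_real_def mult_less_cancel_right)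
    qed
    thus "\<forall>\<^sub>F z in at t0. dist ((U z - U t0) / (z - t0)) (- h t0) < e"
      using \<delta>(1) by (auto simp: eventually_at)
  qed
  \<comment> \<open>At the finitely many singular points and at the ends only continuity is
    required, and this is what the Lipschitz bound supplies.\<close>
  have "(H has_integral (U (arccos y) - U (arccos (-1)))) {-1..y}"
  proof (rule fundamental_theorem_of_calculus_interior_strong[where S = "cos ` Sing"])
    show "finite (cos ` Sing)" using finS by simp
    show "-1 \<le> y" using y by simp
    show "continuous_on {-1..y} (\<lambda>x. U (arccos x))"
      by (rule continuous_on_compose2[OF Ucont])
         (use y in \<open>auto intro!: continuous_on_subset[OF continuous_on_arccos']
            arccos_lbound arccos_ubound\<close>)
    fix x assume x: "x \<in> {-1<..<y} - cos ` Sing"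
    hence x': "-1 < x" "x < 1" using y by auto
    have nS: "arccos x \<notin> Sing"
    proof
      assume "arccos x \<in> Sing"
      hence "cos (arccos x) \<in> cos ` Sing" by (rule imageI)
      thus False using x x' by simp
    qed
    have "0 < arccos x" "arccos x < pi" using arccos_lt_bounded[OF x'] by auto
    from DERIV_chain2[OF Uderiv[OF this nS] DERIV_arccos[OF x']]
    have "((\<lambda>x. U (arccos x)) has_real_derivative H x) (at x)"
      using H[OF x' nS] by (simp add: field_simps)
    thus "((\<lambda>x. U (arccos x)) has_vector_derivative H x) (at x)"
      by (simp add: has_real_derivative_iff_has_vector_derivative)
  qed
  moreover have "U (arccos (-1)) = 0" by (simp add: U_def zero \<Lambda>0)
  ultimately show ?thesis by (simp add: U_def)
qed

text \<open>Integrability of H is a conclusion: the integral is produced once with the upper and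
  once with the lower limit as its value, and its uniqueness forces the two limits to agree.\<close>

lemma density_limit:
  fixes M :: "nat \<Rightarrow> real \<Rightarrow> real"
  assumes finS: "finite Sing"
    and lip: "\<And>s t. 0 \<le> s \<Longrightarrow> s < t \<Longrightarrow> t \<le> pi \<Longrightarrow>
      \<forall>\<^sub>F l in sequentially. 0 \<le> M l s - M l t \<and> M l s - M l t \<le> C * (t - s)"
    and loc: "\<And>t0 \<epsilon>. 0 < t0 \<Longrightarrow> t0 < pi \<Longrightarrow> t0 \<notin> Sing \<Longrightarrow> \<epsilon> > 0 \<Longrightarrow>
      \<exists>\<delta>>0. \<forall>s t. t0 - \<delta> < s \<longrightarrow> s < t \<longrightarrow> t < t0 + \<delta> \<longrightarrow>
        (\<forall>\<^sub>F l in sequentially. \<bar>M l s - M l t - h t0 * (t - s)\<bar> \<le> \<epsilon> * (t - s))"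
    and zero: "\<And>l. M l pi = 0"
    and H: "\<And>x. -1 < x \<Longrightarrow> x < 1 \<Longrightarrow> arccos x \<notin> Sing \<Longrightarrow> H x = h (arccos x) / sqrt (1 - x\<^sup>2)"
    and y: "y \<in> {-1..1}"
  shows "\<exists>v. (H has_integral v) {-1..y} \<and> (\<lambda>l. M l (arccos y)) \<longlonglongrightarrow> v"
proof -
  have bnd: "ev_bounded (\<lambda>l. M l t)" if "0 \<le> t" "t \<le> pi" for t
  proof (cases "t = pi")
    case True
    thus ?thesis by (auto simp: ev_bounded_def zero intro: exI[of _ 0])
  next
    case False
    hence "\<forall>\<^sub>F l in sequentially. 0 \<le> M l t - M l pi \<and> M l t - M l pi \<le> C * (pi - t)"
      using that by (intro lip) auto
    hence "\<forall>\<^sub>F l in sequentially. \<bar>M l t\<bar> \<le> C * (pi - t)"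
      by eventually_elim (simp add: zero)
    thus ?thesis by (auto simp: ev_bounded_def)
  qed
  let ?X = "\<lambda>l. M l (arccos y)"
  have X: "ev_bounded ?X" using y by (intro bnd arccos_lbound arccos_ubound) auto
  have 1: "(H has_integral upper_lim ?X) {-1..y}"
    by (rule density_functional[where \<Lambda> = upper_lim and M = M and h = h and Sing = Sing and C = C])
       (fact upper_lim_mono upper_lim_zero bnd finS lip loc zero H y)+
  have 2: "(H has_integral - upper_lim (\<lambda>l. - ?X l)) {-1..y}"
  proof (rule density_functional[where \<Lambda> = "\<lambda>X. - upper_lim (\<lambda>l. - X l)" and M = M and h = h
        and Sing = Sing and C = C])
    fix X Y d assume XY: "ev_bounded X" "ev_bounded Y" "\<forall>\<^sub>F l in sequentially. X l \<le> Y l + d"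
    have "upper_lim (\<lambda>l. - Y l) \<le> upper_lim (\<lambda>l. - X l) + d"
      by (intro upper_lim_mono ev_bounded_uminus XY eventually_mono[OF XY(3)]) simp
    thus "- upper_lim (\<lambda>l. - X l) \<le> - upper_lim (\<lambda>l. - Y l) + d" by simp
  next
    show "- upper_lim (\<lambda>l. - 0) = 0" by (simp add: upper_lim_zero)
  qed (fact bnd finS lip loc zero H y)+
  have eq: "upper_lim ?X = - upper_lim (\<lambda>l. - ?X l)" by (rule has_integral_unique[OF 1 2])
  have "?X \<longlonglongrightarrow> upper_lim ?X"
  proof (rule order_tendstoI)
    fix r assume "r < upper_lim ?X"
    hence "upper_lim (\<lambda>l. - ?X l) < - r" using eq by simp
    from ev_less_upper_lim[OF ev_bounded_uminus[OF X] this]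
    show "\<forall>\<^sub>F l in sequentially. r < ?X l" by simp
  qed (rule ev_less_upper_lim[OF X])
  with 1 show ?thesis by blast
qed

section \<open>Asymptotics of the zero counts\<close>

text \<open>The function g of the overview, the limit of \<open>liouville_Q\<close> divided by l^2:
  k n, k \<alpha> and k \<gamma>, taken at block l, grow like l, a l and c l.\<close>

definition zero_dens :: "real \<Rightarrow> real \<Rightarrow> nat \<Rightarrow> real \<Rightarrow> real" where
  "zero_dens a c k t = (1 + a + c / 2)\<^sup>2 - a\<^sup>2 / (sin (real k * t))\<^sup>2 - c\<^sup>2 / 4 / (cos (real k * t))\<^sup>2"

text \<open>An error e^2 in the potential costs only e in the frequency, even where g vanishes and
  the square root is not Lipschitz.\<close>

lemma sqrt_add_square_le: "x \<ge> 0 \<Longrightarrow> e \<ge> 0 \<Longrightarrow> sqrt (x + e\<^sup>2) \<le> sqrt x + e"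
  using sqrt_add_le_add_sqrt[of x "e\<^sup>2"] by simp

lemma le_sqrt_diff_square: "e \<ge> 0 \<Longrightarrow> e\<^sup>2 \<le> x \<Longrightarrow> sqrt x - e \<le> sqrt (x - e\<^sup>2)"
  using sqrt_add_square_le[of "x - e\<^sup>2" e] by simp

text \<open>\<open>n l\<close> is odd and \<open>(n l + 1) k - 1\<close> is the index of the subsequence to which the Liouville
  normal form applies; it exceeds \<open>l\<close> by at most \<open>3 k\<close>.\<close>

locale sieved_asymptotics =
  fixes k :: nat and \<alpha> \<gamma> :: "nat \<Rightarrow> real" and a c :: real
  assumes k: "k \<ge> 2" and \<alpha>: "\<And>l. \<alpha> l > -1/2" and \<gamma>: "\<And>l. \<gamma> l > -1"
    and lim\<alpha>: "(\<lambda>l. \<alpha> l / real l) \<longlonglongrightarrow> a" and a: "a \<ge> 0"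
    and lim\<gamma>: "(\<lambda>l. \<gamma> l / real l) \<longlonglongrightarrow> c" and c: "c \<ge> 0"
begin

definition m :: "nat \<Rightarrow> nat" where "m l = (l - 1) div k"
text \<open>The least odd integer that is at least \<open>m l + 1\<close>. Taking \<open>m l\<close>
  in place of it could give the index l - 1, namely when k divides l.\<close>

definition n :: "nat \<Rightarrow> nat" where "n l = 2 * ((m l + 1) div 2) + 1"
definition L :: "nat \<Rightarrow> nat" where "L l = Suc (n l) * k - 1"
definition B :: "nat \<Rightarrow> real poly" where "B l = sieved_B (\<alpha> (m l)) (\<gamma> (m l)) k (L l)"
definition Z :: "nat \<Rightarrow> real set \<Rightarrow> real set" where "Z l A = {t \<in> A. poly (B l) (cos t) = 0}"
text \<open>Cosine reverses the order, so the angles in [t, pi] stand for the zeros x <= cos t. The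
  polynomial has index \<open>L l\<close>, but the divisor is already l.\<close>

definition M :: "nat \<Rightarrow> real \<Rightarrow> real" where "M l t = real (card (Z l {t..pi})) / real l"
definition \<omega> :: "nat \<Rightarrow> real" where
  "\<omega> l = real k * (real (n l) + \<alpha> (m l) + 1 + \<gamma> (m l) / 2)"
definition h :: "real \<Rightarrow> real" where "h t = sqrt (max 0 (zero_dens a c k t)) / pi"
definition Sing :: "real set" where
  "Sing = {t \<in> {0..pi}. sin (real k * t) = 0 \<or> cos (real k * t) = 0}"

lemma k0: "real k > 0" using k by simp

lemma odd_n: "odd (n l)" by (simp add: n_def)

lemma n_bounds: "m l + 1 \<le> n l" "n l \<le> m l + 2"
  by (auto simp: n_def)

lemma L_bounds: assumes "l \<ge> 1" shows "l \<le> L l" "L l \<le> l + 3 * k"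
proof -
  have "l - 1 = k * m l + (l - 1) mod k" by (simp add: m_def)
  moreover have "(l - 1) mod k < k" using k by simp
  ultimately have l: "k * m l + 1 \<le> l" "l \<le> k * m l + k" using assms by linarith+
  have "(m l + 2) * k \<le> Suc (n l) * k" using n_bounds(1)[of l] by (intro mult_right_mono) auto
  moreover have "Suc (n l) * k \<le> (m l + 3) * k" using n_bounds(2)[of l] by (intro mult_right_mono) auto
  ultimately have "k * m l + 2 * k \<le> Suc (n l) * k" "Suc (n l) * k \<le> k * m l + 3 * k"
    by (simp_all add: algebra_simps)
  thus "l \<le> L l" "L l \<le> l + 3 * k" using l k unfolding L_def by linarith+
qed

lemma B_nonzero: "B l \<noteq> 0"
  unfolding B_def by (rule sieved_B_nonzero[OF k \<alpha> \<gamma>])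

lemma finite_Z: "A \<subseteq> {0..pi} \<Longrightarrow> finite (Z l A)"
  unfolding Z_def by (rule finite_zeros_cos[OF B_nonzero])

lemma pi_not_zero: "pi \<notin> Z l A"
  using sieved_B_abs_ge_1[OF k \<alpha>[of "m l"] \<gamma>[of "m l"], of "-1" "L l"] by (auto simp: Z_def B_def)

lemma M_pi: "M l pi = 0"
proof -
  have "Z l {pi..pi} = {}" using pi_not_zero[of l "{pi..pi}"] by (auto simp: Z_def)
  thus ?thesis by (simp add: M_def)
qed

lemma M_diff:
  assumes "0 \<le> s" "s \<le> t" "t \<le> pi"
  shows "M l s - M l t = real (card (Z l {s..<t})) / real l"
proof -
  have sub: "{s..<t} \<subseteq> {0..pi}" "{t..pi} \<subseteq> {0..pi}" using assms by auto
  have "Z l {s..pi} = Z l {s..<t} \<union> Z l {t..pi}" using assms by (auto simp: Z_def)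
  moreover have "Z l {s..<t} \<inter> Z l {t..pi} = {}" by (auto simp: Z_def)
  ultimately have "card (Z l {s..pi}) = card (Z l {s..<t}) + card (Z l {t..pi})"
    using card_Un_disjoint[OF finite_Z[OF sub(1)] finite_Z[OF sub(2)]] by simp
  thus ?thesis by (simp add: M_def add_divide_distrib)
qed

lemma filterlim_m: "filterlim m sequentially sequentially"
  unfolding filterlim_at_top
proof
  fix N
  show "\<forall>\<^sub>F l in sequentially. N \<le> m l"
    using eventually_ge_at_top[of "N * k + 1"]
  proof eventually_elim
    case (elim l)
    hence "N * k div k \<le> (l - 1) div k" by (intro div_le_mono) simp
    thus ?case using k by (simp add: m_def)
  qed
qed

lemma lim_m: "(\<lambda>l. real k * real (m l) / real l) \<longlonglongrightarrow> 1"
proof -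
  have lim: "(\<lambda>l. 1 - real k * (1 / real l)) \<longlonglongrightarrow> 1 - real k * 0"
    by (intro tendsto_intros lim_1_over_n)
  have ev: "\<forall>\<^sub>F l in sequentially. 1 - real k * (1 / real l) \<le> real k * real (m l) / real l \<and>
     real k * real (m l) / real l \<le> 1"
    using eventually_gt_at_top[of 0]
  proof eventually_elim
    case (elim l)
    have "l - 1 = k * m l + (l - 1) mod k" by (simp add: m_def)
    moreover have "(l - 1) mod k < k" using k by simp
    ultimately have "k * m l \<le> l" "l \<le> k * m l + k" using elim by linarith+
    hence "real (k * m l) \<le> real l" "real l \<le> real (k * m l + k)" by (simp_all only: of_nat_le_iff)
    hence "(real l - real k) / real l \<le> real k * real (m l) / real l" "real k * real (m l) / real l \<le> real l / real l"
      by (intro divide_right_mono; simp)+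
    thus ?case using elim by (simp add: diff_divide_distrib)
  qed
  from ev have "\<forall>\<^sub>F l in sequentially. 1 - real k * (1 / real l) \<le> real k * real (m l) / real l"
    "\<forall>\<^sub>F l in sequentially. real k * real (m l) / real l \<le> 1" by (auto elim: eventually_mono)
  from tendsto_sandwich[OF this lim] show ?thesis by simp
qed

lemma lim_n: "(\<lambda>l. real k * real (n l) / real l) \<longlonglongrightarrow> 1"
proof -
  have lim: "(\<lambda>l. real k * real (m l) / real l + 2 * real k * (1 / real l)) \<longlonglongrightarrow> 1 + 2 * real k * 0"
    by (intro tendsto_intros lim_1_over_n lim_m)
  have b: "real k * real (m l) / real l \<le> real k * real (n l) / real l"
     "real k * real (n l) / real l \<le> real k * real (m l) / real l + 2 * real k * (1 / real l)" for l
  proof -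
    have "real (m l) \<le> real (n l)" "real (n l) \<le> real (m l) + 2" using n_bounds[of l] by simp_all
    hence "real k * real (m l) / real l \<le> real k * real (n l) / real l"
      "real k * real (n l) / real l \<le> real k * (real (m l) + 2) / real l"
      by (intro divide_right_mono mult_left_mono; simp)+
    thus "real k * real (m l) / real l \<le> real k * real (n l) / real l"
     "real k * real (n l) / real l \<le> real k * real (m l) / real l + 2 * real k * (1 / real l)"
      by (simp_all add: algebra_simps add_divide_distrib)
  qed
  from lim have lim': "(\<lambda>l. real k * real (m l) / real l + 2 * real k * (1 / real l)) \<longlonglongrightarrow> 1"
    by simp
  show ?thesis
    by (rule tendsto_sandwich[OF _ _ lim_m lim']) (rule always_eventually, rule allI, rule b)+
qed

lemma lim_param:
  assumes "(\<lambda>l. \<beta> l / real l) \<longlonglongrightarrow> b"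
  shows "(\<lambda>l. real k * \<beta> (m l) / real l) \<longlonglongrightarrow> b"
proof -
  have "(\<lambda>l. (\<beta> (m l) / real (m l)) * (real k * real (m l) / real l)) \<longlonglongrightarrow> b * 1"
    by (intro tendsto_mult lim_m filterlim_compose[OF assms filterlim_m])
  moreover have "\<forall>\<^sub>F l in sequentially. (\<beta> (m l) / real (m l)) * (real k * real (m l) / real l)
     = real k * \<beta> (m l) / real l"
    using filterlim_m[unfolded filterlim_at_top, rule_format, of 1]
    by eventually_elim simp
  ultimately show ?thesis by (auto elim: Lim_transform_eventually)
qed

lemma lim_omega: "(\<lambda>l. \<omega> l / real l) \<longlonglongrightarrow> 1 + a + c / 2"
proof -
  have "(\<lambda>l. real k * real (n l) / real l + real k * \<alpha> (m l) / real l + real k * (1 / real l)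
      + (real k * \<gamma> (m l) / real l) / 2) \<longlonglongrightarrow> 1 + a + real k * 0 + c / 2"
    by (intro tendsto_intros lim_1_over_n lim_n lim_param lim\<alpha> lim\<gamma>) simp
  thus ?thesis by (simp add: \<omega>_def algebra_simps add_divide_distrib)
qed

text \<open>The product filter lets l and t vary jointly. This encodes the uniformity needed: one
  neighbourhood of t0 serves all large l.\<close>

lemma lim_Q:
  assumes "sin (real k * t0) \<noteq> 0" "cos (real k * t0) \<noteq> 0"
  shows "((\<lambda>(l, t). liouville_Q (\<alpha> (m l)) (\<gamma> (m l)) (real k) (n l) t / (real l)\<^sup>2) \<longlongrightarrow> zero_dens a c k t0)
     (sequentially \<times>\<^sub>F nhds t0)"
proof -
  define P where "P p = (\<omega> (fst p) / real (fst p))\<^sup>2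
      - (real k * \<alpha> (m (fst p)) / real (fst p)) * (real k * \<alpha> (m (fst p)) / real (fst p)
          + real k * (1 / real (fst p))) / (sin (real k * snd p))\<^sup>2
      - (real k * \<gamma> (m (fst p)) / real (fst p)) * (real k * \<gamma> (m (fst p)) / real (fst p)
          + 2 * real k * (1 / real (fst p))) / 4 / (cos (real k * snd p))\<^sup>2" for p :: "nat \<times> real"
  have fst': "((\<lambda>p. X (fst p)) \<longlongrightarrow> x) (sequentially \<times>\<^sub>F nhds t0)" if "X \<longlonglongrightarrow> x" for X and x :: real
    by (rule filterlim_compose[OF that filterlim_fst])
  have snd': "(snd \<longlongrightarrow> t0) (sequentially \<times>\<^sub>F nhds t0)" by (rule filterlim_snd)
  have "(P \<longlongrightarrow> (1 + a + c / 2)\<^sup>2 - a * (a + real k * 0) / (sin (real k * t0))\<^sup>2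
        - c * (c + 2 * real k * 0) / 4 / (cos (real k * t0))\<^sup>2) (sequentially \<times>\<^sub>F nhds t0)"
    unfolding P_def
    by (intro tendsto_intros fst'[OF lim_omega] fst'[OF lim_param[OF lim\<alpha>]] fst'[OF lim_param[OF lim\<gamma>]]
        fst'[OF lim_1_over_n] snd') (use assms in auto)
  moreover have "P = (\<lambda>(l, t). liouville_Q (\<alpha> (m l)) (\<gamma> (m l)) (real k) (n l) t / (real l)\<^sup>2)"
  proof (rule ext, clarify)
    fix l t
    have "liouville_Q (\<alpha> (m l)) (\<gamma> (m l)) (real k) (n l) t / (real l)\<^sup>2 = (\<omega> l)\<^sup>2 / (real l)\<^sup>2
       - ((real k)\<^sup>2 * (\<alpha> (m l) * (\<alpha> (m l) + 1)) / (real l)\<^sup>2) / (sin (real k * t))\<^sup>2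
       - ((real k)\<^sup>2 * (\<gamma> (m l) * (\<gamma> (m l) + 2)) / (real l)\<^sup>2) / 4 / (cos (real k * t))\<^sup>2"
      unfolding liouville_Q_def \<omega>_def power_mult_distrib right_diff_distrib diff_divide_distrib
      by (simp add: mult.commute)
    also have "(real k)\<^sup>2 * (\<alpha> (m l) * (\<alpha> (m l) + 1)) / (real l)\<^sup>2
       = (real k * \<alpha> (m l) / real l) * (real k * \<alpha> (m l) / real l + real k * (1 / real l))"
      by (simp add: power2_eq_square algebra_simps add_divide_distrib)
    also have "(real k)\<^sup>2 * (\<gamma> (m l) * (\<gamma> (m l) + 2)) / (real l)\<^sup>2
       = (real k * \<gamma> (m l) / real l) * (real k * \<gamma> (m l) / real l + 2 * real k * (1 / real l))"
      by (simp add: power2_eq_square algebra_simps add_divide_distrib)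
    finally show "P (l, t) = liouville_Q (\<alpha> (m l)) (\<gamma> (m l)) (real k) (n l) t / (real l)\<^sup>2"
      by (simp add: P_def power_divide)
  qed
  ultimately show ?thesis by (simp add: zero_dens_def power2_eq_square)
qed

lemma M_lipschitz:
  obtains C where "\<And>s t. 0 \<le> s \<Longrightarrow> s < t \<Longrightarrow> t \<le> pi \<Longrightarrow>
      \<forall>\<^sub>F l in sequentially. 0 \<le> M l s - M l t \<and> M l s - M l t \<le> C * (t - s)"
proof
  \<comment> \<open>Each of 4k cells contributes 2 \<omega>/pi per unit length, and
    \<open>\<omega> l / real l\<close> is eventually below 2 + a + c/2. The summand 1 absorbs
    (8k+1)/l, which is below t - s once l is large for the given s and t.\<close>
  define C where "C = 8 * real k * (2 + a + c / 2) / pi + 1"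
  fix s t :: real assume st: "0 \<le> s" "s < t" "t \<le> pi"
  have 1: "\<forall>\<^sub>F l in sequentially. \<omega> l / real l < 2 + a + c / 2"
    using lim_omega by (rule order_tendstoD(2)) simp
  have "(\<lambda>l. (8 * real k + 1) * (1 / real l)) \<longlonglongrightarrow> (8 * real k + 1) * 0"
    by (intro tendsto_intros lim_1_over_n)
  hence 2: "\<forall>\<^sub>F l in sequentially. (8 * real k + 1) * (1 / real l) < t - s"
    by (rule order_tendstoD(2)) (use st in simp)
  show "\<forall>\<^sub>F l in sequentially. 0 \<le> M l s - M l t \<and> M l s - M l t \<le> C * (t - s)"
    using 1 2 eventually_gt_at_top[of 0]
  proof eventually_elim
    case (elim l)
    have d: "M l s - M l t = real (card (Z l {s..<t})) / real l" using st by (intro M_diff) auto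
    have "real (card (Z l {s..<t})) \<le> 4 * real k * ((t - s) * (2 * \<omega> l) / pi + 1) + (4 * real k + 1)"
      unfolding Z_def B_def L_def \<omega>_def using st
      by (intro sieved_zeros_lipschitz k \<alpha> \<gamma> odd_n) auto
    hence "real (card (Z l {s..<t})) / real l
        \<le> (4 * real k * ((t - s) * (2 * \<omega> l) / pi + 1) + (4 * real k + 1)) / real l"
      using elim by (intro divide_right_mono) auto
    also have "\<dots> = 8 * real k / pi * (t - s) * (\<omega> l / real l) + (8 * real k + 1) * (1 / real l)"
      using elim by (simp add: field_simps)
    also have "\<dots> \<le> 8 * real k / pi * (t - s) * (2 + a + c / 2) + (t - s)"
      using elim st by (intro add_mono mult_left_mono) auto
    also have "\<dots> = C * (t - s)" by (simp add: C_def algebra_simps)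
    finally show ?case by (simp add: d)
  qed
qed

text \<open>Near t0 the quotient Q/l^2 lies within e'^2 of g. Comparison with the constant
  potentials l^2 (max 0 g + e'^2) and, where positive, l^2 (g - e'^2) encloses the count.\<close>

lemma M_local:
  assumes t0: "0 < t0" "t0 < pi" "t0 \<notin> Sing" and e: "\<epsilon> > 0"
  shows "\<exists>\<delta>>0. \<forall>s t. t0 - \<delta> < s \<longrightarrow> s < t \<longrightarrow> t < t0 + \<delta> \<longrightarrow>
        (\<forall>\<^sub>F l in sequentially. \<bar>M l s - M l t - h t0 * (t - s)\<bar> \<le> \<epsilon> * (t - s))"
proof -
  define g where "g = zero_dens a c k t0"
  \<comment> \<open>Half of the tolerance pays for the frequency error e'/pi, the other half for the
    error of one zero in the counts, which is 1/l after normalization.\<close>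
  define e' where "e' = pi * \<epsilon> / 2"
  have e': "e' > 0" using e by (simp add: e'_def)
  have nz0: "sin (real k * t0) \<noteq> 0" "cos (real k * t0) \<noteq> 0" using t0 by (auto simp: Sing_def)
  from lim_Q[OF nz0] have "\<forall>\<^sub>F p in sequentially \<times>\<^sub>F nhds t0.
      dist ((\<lambda>(l, t). liouville_Q (\<alpha> (m l)) (\<gamma> (m l)) (real k) (n l) t / (real l)\<^sup>2) p) g < e'\<^sup>2"
    unfolding g_def by (rule tendstoD) (use e' in simp)
  then obtain P1 P2 where P: "eventually P1 sequentially" "eventually P2 (nhds t0)"
    "\<And>l t. P1 l \<Longrightarrow> P2 t \<Longrightarrow>
       \<bar>liouville_Q (\<alpha> (m l)) (\<gamma> (m l)) (real k) (n l) t / (real l)\<^sup>2 - g\<bar> < e'\<^sup>2"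
    unfolding eventually_prod_filter by (auto simp: dist_real_def)
  have "\<forall>\<^sub>F t in nhds t0. sin (real k * t) \<noteq> 0" "\<forall>\<^sub>F t in nhds t0. cos (real k * t) \<noteq> 0"
    using nz0 by (auto intro!: tendsto_imp_eventually_ne tendsto_eq_intros filterlim_ident)
  moreover have "\<forall>\<^sub>F t in nhds t0. 0 < t" "\<forall>\<^sub>F t in nhds t0. t < pi"
    using order_tendstoD[OF filterlim_ident[of "nhds t0"]] t0 by auto
  ultimately have "\<forall>\<^sub>F t in nhds t0. P2 t \<and> sin (real k * t) \<noteq> 0 \<and> cos (real k * t) \<noteq> 0 \<and> 0 < t \<and> t < pi"
    using P(2) by eventually_elim auto
  then obtain \<delta> where \<delta>: "\<delta> > 0" "\<And>t. dist t t0 < \<delta> \<Longrightarrow>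
      P2 t \<and> sin (real k * t) \<noteq> 0 \<and> cos (real k * t) \<noteq> 0 \<and> 0 < t \<and> t < pi"
    unfolding eventually_nhds_metric by auto
  have "\<forall>\<^sub>F l in sequentially. \<bar>M l s - M l t - h t0 * (t - s)\<bar> \<le> \<epsilon> * (t - s)"
    if st: "t0 - \<delta> < s" "s < t" "t < t0 + \<delta>" for s t
  proof -
    have near: "P2 x" "sin (real k * x) \<noteq> 0" "cos (real k * x) \<noteq> 0" "0 < x" "x < pi"
      if "x \<in> {s..t}" for x
    proof -
      have "dist x t0 < \<delta>" using that st by (auto simp: dist_real_def abs_less_iff)
      from \<delta>(2)[OF this] show "P2 x" "sin (real k * x) \<noteq> 0" "cos (real k * x) \<noteq> 0" "0 < x" "x < pi"
        by auto
    qed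
    have dom: "0 \<le> s" "t \<le> pi" using near[of s] near[of t] st by auto
    have "\<forall>\<^sub>F l in sequentially. 1 / real l < \<epsilon> / 2 * (t - s)"
      using lim_1_over_n by (rule order_tendstoD(2)) (use e st in simp)
    thus ?thesis using P(1) eventually_gt_at_top[of 0]
    proof eventually_elim
      case (elim l)
      let ?F = "liouville_F (\<alpha> (m l)) (\<gamma> (m l)) (real k) (n l)"
      let ?F1 = "liouville_F1 (\<alpha> (m l)) (\<gamma> (m l)) (real k) (n l)"
      let ?Q = "liouville_Q (\<alpha> (m l)) (\<gamma> (m l)) (real k) (n l)"
      have l: "real l > 0" using elim by simp
      have Zeq: "Z l {s..<t} = {x \<in> {s..<t}. ?F x = 0}"
        using sieved_B_zero_iff_liouville_F[OF k \<gamma> near(2)] by (auto simp: Z_def B_def L_def)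
      have fin: "finite {x \<in> {s..<t}. ?F x = 0}"
        unfolding Zeq[symmetric] using dom by (intro finite_Z) auto
      have dF: "(?F has_real_derivative ?F1 x) (at x)" "(?F1 has_real_derivative - ?Q x * ?F x) (at x)"
        if "x \<in> {s..t}" for x
        using has_derivative_liouville_F[OF near(2,3)] has_derivative_liouville_F1[OF near(2,3) \<gamma> odd_n] that by auto
      have Q: "g - e'\<^sup>2 < ?Q x / (real l)\<^sup>2" "?Q x / (real l)\<^sup>2 < g + e'\<^sup>2" if "x \<in> {s..t}" for x
        using P(3)[OF elim(2) near(1)[OF that]] unfolding abs_less_iff by linarith+
      have d: "M l s - M l t = real (card (Z l {s..<t})) / real l"
        using dom st by (intro M_diff) auto
      have hpi: "h t0 * (t - s) = (t - s) * sqrt (max 0 g) / pi" by (simp add: h_def g_def)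
      have half: "\<epsilon> / 2 * (t - s) = (t - s) * e' / pi" by (simp add: e'_def)
      have upper: "M l s - M l t \<le> h t0 * (t - s) + \<epsilon> * (t - s)"
      proof -
        define w where "w = sqrt (max 0 g + e'\<^sup>2)"
        have w: "w > 0" "w \<le> sqrt (max 0 g) + e'"
          using e' sqrt_add_square_le[of "max 0 g" e'] by (auto simp: w_def intro!: add_nonneg_pos)
        have w2: "w\<^sup>2 = max 0 g + e'\<^sup>2" by (simp add: w_def)
        have "real (card {x \<in> {s..<t}. ?F x = 0}) \<le> (t - s) * (real l * w) / pi + 1"
        proof (rule count_zeros_le[OF _ _ fin])
          fix x assume "x \<in> {s..<t}"
          hence x: "x \<in> {s..t}" by auto
          show "(?F has_real_derivative ?F1 x) (at x)" "(?F1 has_real_derivative - ?Q x * ?F x) (at x)"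
            using dF[OF x] by auto
          have "?Q x / (real l)\<^sup>2 \<le> w\<^sup>2" using Q(2)[OF x] unfolding w2 by linarith
          thus "?Q x \<le> (real l * w)\<^sup>2" using l by (simp add: field_simps power_mult_distrib)
        qed (use st l w in auto)
        hence "M l s - M l t \<le> ((t - s) * (real l * w) / pi + 1) / real l"
          unfolding d Zeq using l by (intro divide_right_mono) auto
        also have "\<dots> = (t - s) * w / pi + 1 / real l" using l by (simp add: field_simps)
        also have "\<dots> \<le> (t - s) * (sqrt (max 0 g) + e') / pi + \<epsilon> / 2 * (t - s)"
          using w elim st by (intro add_mono divide_right_mono mult_left_mono) auto
        also have "\<dots> = h t0 * (t - s) + 2 * (\<epsilon> / 2 * (t - s))"
          unfolding hpi half by (simp add: field_simps)
        finally show ?thesis by simp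
      qed
      have lower: "M l s - M l t \<ge> h t0 * (t - s) - \<epsilon> * (t - s)"
      proof (cases "g > e'\<^sup>2")
        case False
        hence "max 0 g \<le> e'\<^sup>2" by simp
        hence "sqrt (max 0 g) \<le> e'" using e' by (intro real_le_lsqrt) auto
        hence "h t0 * (t - s) \<le> \<epsilon> / 2 * (t - s)"
          unfolding hpi half using st by (intro divide_right_mono mult_left_mono) auto
        also have "\<dots> \<le> \<epsilon> * (t - s)" using e st by simp
        finally have "h t0 * (t - s) - \<epsilon> * (t - s) \<le> 0" by simp
        also have "\<dots> \<le> M l s - M l t" unfolding d by simp
        finally show ?thesis .
      next
        case True
        define w where "w = sqrt (g - e'\<^sup>2)"
        have g: "max 0 g = g" using True by (smt (verit) zero_le_power2)
        have w: "w > 0" "sqrt (max 0 g) - e' \<le> w" unfolding g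
          using e' True le_sqrt_diff_square[of e' g] by (auto simp: w_def)
        have w2: "w\<^sup>2 = g - e'\<^sup>2" using True by (simp add: w_def)
        have "real (card {x \<in> {s..<t}. ?F x = 0}) \<ge> (t - s) * (real l * w) / pi - 1"
        proof (rule count_zeros_ge[OF _ fin])
          fix x assume x: "x \<in> {s..t}"
          show "(?F has_real_derivative ?F1 x) (at x)" "(?F1 has_real_derivative - ?Q x * ?F x) (at x)"
            using dF[OF x] by auto
          have "?Q x / (real l)\<^sup>2 \<ge> w\<^sup>2" using Q(1)[OF x] unfolding w2 by linarith
          thus "?Q x \<ge> (real l * w)\<^sup>2" using l by (simp add: field_simps power_mult_distrib)
        qed (use l w in auto)
        hence "M l s - M l t \<ge> ((t - s) * (real l * w) / pi - 1) / real l"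
          unfolding d Zeq using l by (intro divide_right_mono) auto
        also have "((t - s) * (real l * w) / pi - 1) / real l = (t - s) * w / pi - 1 / real l"
          using l by (simp add: field_simps)
        finally have "(t - s) * w / pi - 1 / real l \<le> M l s - M l t" .
        moreover have "(t - s) * (sqrt (max 0 g) - e') / pi - \<epsilon> / 2 * (t - s) \<le> (t - s) * w / pi - 1 / real l"
          using w elim st by (intro diff_mono divide_right_mono mult_left_mono) auto
        moreover have "(t - s) * (sqrt (max 0 g) - e') / pi - \<epsilon> / 2 * (t - s)
            = h t0 * (t - s) - 2 * (\<epsilon> / 2 * (t - s))"
          unfolding hpi half by (simp add: field_simps)
        ultimately show ?thesis by simp
      qed
      show ?case using upper lower unfolding abs_le_iff by linarith
    qed
  qed
  with \<delta>(1) show ?thesis by blast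
qed

lemma finite_Sing: "finite Sing"
proof (rule finite_subset)
  show "Sing \<subseteq> insert pi ((\<lambda>i. real i * pi / (4 * real k)) ` {..<4 * k})"
  proof
    fix t assume t: "t \<in> Sing"
    show "t \<in> insert pi ((\<lambda>i. real i * pi / (4 * real k)) ` {..<4 * k})"
    proof (cases "t = pi")
      case False
      hence t': "0 \<le> t" "t < pi" using t by (auto simp: Sing_def)
      obtain i where "i < 4 * k" "t = real i * pi / (4 * real k)
          \<or> t \<in> {real i * pi / (4 * real k)<..<real (i + 1) * pi / (4 * real k)}"
        using quarter_cover[of k t] t' k by auto
      thus ?thesis using sin_cos_nonzero_quarter[OF k0, of t i] t by (auto simp: Sing_def)
    qed simp
  qed
qed simp

text \<open>All real zeros lie in (-1, 1) by \<open>sieved_B_abs_ge_1\<close>, so none is lost under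
  the substitution x = cos t.\<close>

lemma count_eq_card_Z:
  assumes y: "y \<in> {-1..1}"
  shows "sieved_zero_count (\<alpha> (m l)) (\<gamma> (m l)) k (L l) y = card (Z l {arccos y..pi})"
proof -
  have "cos ` Z l {arccos y..pi} = {x. x \<le> y \<and> poly (B l) x = 0}"
  proof safe
    fix t assume "t \<in> Z l {arccos y..pi}"
    hence t: "arccos y \<le> t" "t \<le> pi" "poly (B l) (cos t) = 0" by (auto simp: Z_def)
    have "cos t \<le> cos (arccos y)" using t y by (intro cos_monotone_0_pi_le arccos_lbound) auto
    thus "cos t \<le> y" "poly (B l) (cos t) = 0" using y t by auto
  next
    fix x assume x: "x \<le> y" "poly (B l) x = 0"
    hence "\<not> \<bar>x\<bar> \<ge> 1"
      using sieved_B_abs_ge_1[OF k \<alpha>[of "m l"] \<gamma>[of "m l"], of x "L l"] by (auto simp: B_def)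
    hence x1: "-1 \<le> x" "x \<le> 1" by auto
    hence "arccos y \<le> arccos x" using x y by (intro arccos_le_mono[THEN iffD2]) auto
    hence "arccos x \<in> Z l {arccos y..pi}" using x x1 by (auto simp: Z_def arccos_ubound)
    moreover have "x = cos (arccos x)" using x1 by simp
    ultimately show "x \<in> cos ` Z l {arccos y..pi}" by blast
  qed
  moreover have "inj_on cos (Z l {arccos y..pi})"
    by (rule inj_onI, rule cos_inj_pi) (use arccos_lbound[of y] y in \<open>auto simp: Z_def\<close>)
  ultimately have "card {x. x \<le> y \<and> poly (B l) x = 0} = card (Z l {arccos y..pi})"
    using card_image by fastforce
  thus ?thesis by (simp add: sieved_zero_count_def B_def)
qed

text \<open>The passage from index l to \<open>L l\<close> keeps the parameters of l, so interlacing
  within one family applies and changes the count by at most 3k.\<close>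

lemma count_tendsto:
  assumes y: "y \<in> {-1..1}" and v: "(\<lambda>l. M l (arccos y)) \<longlonglongrightarrow> v"
  shows "(\<lambda>l. real (sieved_zero_count (\<alpha> (m l)) (\<gamma> (m l)) k l y) / real l) \<longlonglongrightarrow> v"
proof -
  have "(\<lambda>l. real (sieved_zero_count (\<alpha> (m l)) (\<gamma> (m l)) k l y) / real l - M l (arccos y)) \<longlonglongrightarrow> 0"
  proof (rule Lim_null_comparison)
    show "\<forall>\<^sub>F l in sequentially. norm (real (sieved_zero_count (\<alpha> (m l)) (\<gamma> (m l)) k l y) / real l
        - M l (arccos y)) \<le> 3 * real k * (1 / real l)"
      using eventually_ge_at_top[of 1]
    proof eventually_elim
      case (elim l)
      let ?c = "\<lambda>j. real (sieved_zero_count (\<alpha> (m l)) (\<gamma> (m l)) k j y)"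
      have "\<bar>?c (l + (L l - l)) - ?c l\<bar> \<le> real (L l - l)"
        by (rule sieved_zero_count_shift[OF k \<alpha> \<gamma>])
      also have "l + (L l - l) = L l" using L_bounds(1)[OF elim] by simp
      also have "real (L l - l) \<le> real (3 * k)" using L_bounds(2)[OF elim] by (intro of_nat_mono) linarith
      finally have "\<bar>?c l - ?c (L l)\<bar> / real l \<le> 3 * real k / real l"
        by (intro divide_right_mono) (simp_all add: abs_minus_commute)
      moreover have "?c l / real l - M l (arccos y) = (?c l - ?c (L l)) / real l"
        by (simp add: M_def count_eq_card_Z[OF y] diff_divide_distrib)
      ultimately show ?case by (simp add: abs_divide)
    qed
    have "(\<lambda>l. 3 * real k * (1 / real l)) \<longlonglongrightarrow> 3 * real k * 0"
      by (intro tendsto_intros lim_1_over_n)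
    thus "(\<lambda>l. 3 * real k * (1 / real l)) \<longlonglongrightarrow> 0" by simp
  qed
  from tendsto_add[OF this v] show ?thesis by simp
qed

end

section \<open>Identification of the limit with the stated integral\<close>

text \<open>Clearing denominators in g gives u(1-u)(X/2)^2 - a^2 u - (c^2/4)(1-u) with X = 2a + c +
  2. Completing the square in u yields kappa as the midpoint of its roots and 2 sqrt(mu) as half
  their distance.\<close>

lemma zero_dens_eq:
  assumes "a \<ge> 0" "c \<ge> 0" "sin (real k * t) \<noteq> 0" "cos (real k * t) \<noteq> 0"
  defines "u \<equiv> (cos (real k * t))\<^sup>2"
  shows "(2 * a + c + 2)\<^sup>2 / 4 * (4 * mu_lim a c - (u - kappa_lim a c)\<^sup>2)
    = (sin (real k * t))\<^sup>2 * u * zero_dens a c k t"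
proof -
  define X where "X = 2 * a + c + 2"
  have X: "X \<noteq> 0" using assms by (simp add: X_def)
  have s: "(sin (real k * t))\<^sup>2 = 1 - u" by (simp add: u_def sin_squared_eq)
  have u0: "u \<noteq> 0" "1 - u \<noteq> 0" using assms s by auto
  have m: "mu_lim a c * X ^ 4 = (2 * a + 1) * (c + 1) * (2 * a + c + 1)"
    using X by (simp add: mu_lim_def X_def)
  have ka: "kappa_lim a c * X\<^sup>2 = (2 * a + 1) * (c + 2) + c * (c + 1)"
    using X by (simp add: kappa_lim_def X_def)
  have "X\<^sup>2 * (X\<^sup>2 / 4 * (4 * mu_lim a c - (u - kappa_lim a c)\<^sup>2))
      = mu_lim a c * X ^ 4 - (u * X\<^sup>2 - kappa_lim a c * X\<^sup>2)\<^sup>2 / 4"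
    by (simp add: field_simps power2_eq_square power4_eq_xxxx)
  also have "\<dots> = X\<^sup>2 * ((X / 2)\<^sup>2 * (1 - u) * u - a\<^sup>2 * u - c\<^sup>2 / 4 * (1 - u))"
    unfolding m ka unfolding X_def by (simp add: field_simps power2_eq_square)
  also have "(X / 2)\<^sup>2 * (1 - u) * u - a\<^sup>2 * u - c\<^sup>2 / 4 * (1 - u)
      = (1 - u) * u * ((X / 2)\<^sup>2 - a\<^sup>2 / (1 - u) - c\<^sup>2 / 4 / u)"
  proof -
    have "(1 - u) * (1 / (1 - u)) = 1" "u * (1 / u) = 1" using u0 by auto
    hence "P * (1 - u) * u - a\<^sup>2 * u - Q * (1 - u)
        = (1 - u) * u * (P - a\<^sup>2 * (1 / (1 - u)) - Q * (1 / u))" for P Q by algebra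
    from this[of "(X / 2)\<^sup>2" "c\<^sup>2 / 4"] show ?thesis by simp
  qed
  also have "X / 2 = 1 + a + c / 2" by (simp add: X_def field_simps)
  finally have "X\<^sup>2 / 4 * (4 * mu_lim a c - (u - kappa_lim a c)\<^sup>2)
      = (1 - u) * u * ((1 + a + c / 2)\<^sup>2 - a\<^sup>2 / (1 - u) - c\<^sup>2 / 4 / u)"
    by (rule mult_left_cancel[THEN iffD1, rotated]) (use X in simp)
  thus ?thesis unfolding zero_dens_def u_def[symmetric] s X_def .
qed

definition dens_integrand :: "real \<Rightarrow> real \<Rightarrow> nat \<Rightarrow> real \<Rightarrow> real" where
  "dens_integrand a c k x = sqrt (4 * mu_lim a c - ((poly (cheb_T k) x)\<^sup>2 - kappa_lim a c)\<^sup>2)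
           / (\<bar>poly (cheb_U (k - 1)) x\<bar> * \<bar>poly (cheb_T k) x\<bar> * (1 - x\<^sup>2))
           * indicator (closure (E_set k (kappa_lim a c) (mu_lim a c))) x"

text \<open>The real \<open>sqrt\<close> is negative at negative arguments, so the indicator
  performs the truncation. By continuity D >= 0 on the closure, and points with D = 0 contribute 0
  whether or not they belong to it.\<close>

lemma E_set_closure_cases:
  fixes ka mu x :: real and k :: nat
  assumes "x \<in> {-1..1}"
  defines "D \<equiv> 4 * mu - ((poly (cheb_T k) x)\<^sup>2 - ka)\<^sup>2"
  shows "sqrt D * indicator (closure (E_set k ka mu)) x = sqrt (max 0 D)"
proof -
  have "closure (E_set k ka mu) \<subseteq> {x. \<bar>(poly (cheb_T k) x)\<^sup>2 - ka\<bar>\<^sup>2 \<le> 4 * mu}"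
    by (rule closure_minimal) (auto simp: E_set_def intro!: closed_Collect_le continuous_intros)
  hence "x \<notin> closure (E_set k ka mu)" if "D < 0" using that by (auto simp: D_def)
  moreover have "x \<in> closure (E_set k ka mu)" if "D > 0"
    using that assms(1) closure_subset[of "E_set k ka mu"] by (auto simp: D_def E_set_def)
  ultimately show ?thesis by (cases D "0::real" rule: linorder_cases) auto
qed

text \<open>With x = cos t one has |U_{k-1}(x)| = |sin kt|/sin t and T_k(x) = cos kt. The
  denominator becomes |sin kt cos kt| sin t, whose first factor cancels the square root of the
  factor in \<open>zero_dens_eq\<close>.\<close>

lemma dens_integrand_eq:
  assumes ac: "a \<ge> 0" "c \<ge> 0" and k: "k \<ge> 2" and x: "-1 < x" "x < 1"
    and nz: "sin (real k * arccos x) \<noteq> 0" "cos (real k * arccos x) \<noteq> 0"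
  shows "(2 * a + c + 2) / (2 * pi) * dens_integrand a c k x
    = sqrt (max 0 (zero_dens a c k (arccos x))) / pi / sqrt (1 - x\<^sup>2)"
proof -
  define t s C D X q where "t = arccos x" "s = sin (real k * t)" "C = cos (real k * t)"
    "D = 4 * mu_lim a c - ((poly (cheb_T k) x)\<^sup>2 - kappa_lim a c)\<^sup>2" "X = 2 * a + c + 2"
    "q = sqrt (1 - x\<^sup>2)"
  note d = this
  have xt: "x = cos t" using x by (simp add: d)
  have q: "q > 0" "q\<^sup>2 = 1 - x\<^sup>2" "sin t = q"
    using x by (auto simp: d abs_square_less_1 sin_arccos power2_less_1_iff less_imp_le abs_square_le_1)
  have X: "X > 0" using ac by (simp add: d)
  have T: "poly (cheb_T k) x = C" by (simp add: xt cheb_T_cos d(3))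
  have "q * poly (cheb_U (k - 1)) x = s"
    using cheb_U_cos[of t "k - 1"] k by (simp add: q flip: xt d(2))
  hence U: "poly (cheb_U (k - 1)) x = s / q" using q by (simp add: field_simps)
  have nz': "s \<noteq> 0" "C \<noteq> 0" using nz by (auto simp: d)
  have key: "(X / 2)\<^sup>2 * D = (s * C)\<^sup>2 * zero_dens a c k t"
    using zero_dens_eq[OF ac, of k t] nz' T unfolding d by (simp add: power_divide power_mult_distrib)
  have "X / 2 * sqrt (max 0 D) = sqrt (max 0 ((X / 2)\<^sup>2 * D))"
    using X by (simp add: max_def real_sqrt_mult zero_le_mult_iff)
  also have "\<dots> = \<bar>s * C\<bar> * sqrt (max 0 (zero_dens a c k t))"
    unfolding key using nz' by (simp add: max_def real_sqrt_mult zero_le_mult_iff)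
  finally have num: "X / 2 * sqrt (max 0 D) = \<bar>s * C\<bar> * sqrt (max 0 (zero_dens a c k t))" .
  have "dens_integrand a c k x = sqrt (max 0 D) / (\<bar>s / q\<bar> * \<bar>C\<bar> * q\<^sup>2)"
    unfolding dens_integrand_def T U q(2)
    using E_set_closure_cases[of x "mu_lim a c" k "kappa_lim a c"] x unfolding T d(4) by simp
  also have "\<bar>s / q\<bar> * \<bar>C\<bar> * q\<^sup>2 = \<bar>s * C\<bar> * q"
    using q(1) by (simp add: abs_mult power2_eq_square)
  finally have "X / (2 * pi) * dens_integrand a c k x = (X / 2 * sqrt (max 0 D)) / (\<bar>s * C\<bar> * q) / pi"
    by simp
  also have "\<dots> = sqrt (max 0 (zero_dens a c k t)) / pi / q"
    unfolding num using nz' by simp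
  finally show ?thesis by (simp only: d)
qed

lemma dens_integrand_nonneg: "x \<in> {-1..1} \<Longrightarrow> dens_integrand a c k x \<ge> 0"
proof -
  assume x: "x \<in> {-1..1}"
  have "1 - x\<^sup>2 \<ge> 0" using x by (simp add: abs_square_le_1 abs_le_iff)
  hence "sqrt (max 0 (4 * mu_lim a c - ((poly (cheb_T k) x)\<^sup>2 - kappa_lim a c)\<^sup>2))
     / (\<bar>poly (cheb_U (k - 1)) x\<bar> * \<bar>poly (cheb_T k) x\<bar> * (1 - x\<^sup>2)) \<ge> 0" by simp
  thus ?thesis using E_set_closure_cases[OF x, of "mu_lim a c" k "kappa_lim a c"]
    by (simp add: dens_integrand_def)
qed

lemma measurable_poly [measurable]: "poly p \<in> borel_measurable (borel :: real measure)" for p :: "real poly"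
  by (intro borel_measurable_continuous_onI continuous_intros)

lemma measurable_dens_integrand [measurable]: "dens_integrand a c k \<in> borel_measurable borel"
proof -
  have [measurable]: "closure (E_set k (kappa_lim a c) (mu_lim a c)) \<in> sets borel" by simp
  show ?thesis unfolding dens_integrand_def[abs_def] by measurable
qed

text \<open>The fundamental theorem yields a gauge integral; nonnegativity makes it absolutely
  convergent, hence a Lebesgue integral. The last step descends from the completed measure to the
  Borel one used by \<open>LBINT\<close>.\<close>

lemma set_lebesgue_integral_nonneg_eq_integral:
  fixes f :: "real \<Rightarrow> real"
  assumes [measurable]: "f \<in> borel_measurable borel" "S \<in> sets borel"
    and f: "(f has_integral v) S" "\<And>x. x \<in> S \<Longrightarrow> f x \<ge> 0"
  shows "(LBINT x:S. f x) = v"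
proof -
  have "f absolutely_integrable_on S"
    using f by (intro nonnegative_absolutely_integrable_1) auto
  hence "set_lebesgue_integral lebesgue S f = integral S f"
    by (rule set_lebesgue_integral_eq_integral(2))
  moreover have "set_lebesgue_integral lebesgue S f = (LBINT x:S. f x)"
    unfolding set_lebesgue_integral_def by (rule integral_completion) simp
  ultimately show ?thesis using f(1) by (simp add: integral_unique)
qed

theorem theorem4p4:
  fixes k :: nat and \<alpha> \<gamma> :: "nat \<Rightarrow> real" and a c :: real
  assumes "k \<ge> 2"
    and "\<And>l. \<alpha> l > -1/2"
    and "\<And>l. \<gamma> l > -1"
    and "(\<lambda>l. \<alpha> l / real l) \<longlonglongrightarrow> a" and "a \<ge> 0"
    and "(\<lambda>l. \<gamma> l / real l) \<longlonglongrightarrow> c" and "c \<ge> 0"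
  shows "\<forall>y\<in>{-1..1}.
    (\<lambda>l. real (sieved_zero_count (\<alpha> ((l - 1) div k)) (\<gamma> ((l - 1) div k)) k l y) / real l)
      \<longlonglongrightarrow> (2 * a + c + 2) / (2 * pi) *
        (LBINT x:{-1..y}.
           sqrt (4 * mu_lim a c - ((poly (cheb_T k) x)\<^sup>2 - kappa_lim a c)\<^sup>2)
           / (\<bar>poly (cheb_U (k - 1)) x\<bar> * \<bar>poly (cheb_T k) x\<bar> * (1 - x\<^sup>2))
           * indicator (closure (E_set k (kappa_lim a c) (mu_lim a c))) x)"
proof
  fix y :: real assume y: "y \<in> {-1..1}"
  interpret sieved_asymptotics k \<alpha> \<gamma> a c by unfold_locales (fact assms)+
  define K where "K = (2 * a + c + 2) / (2 * pi)"
  have K: "K > 0" using assms by (simp add: K_def)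
  obtain C where C: "\<And>s t. 0 \<le> s \<Longrightarrow> s < t \<Longrightarrow> t \<le> pi \<Longrightarrow>
      \<forall>\<^sub>F l in sequentially. 0 \<le> M l s - M l t \<and> M l s - M l t \<le> C * (t - s)"
    using M_lipschitz by blast
  have "\<exists>v. ((\<lambda>x. K * dens_integrand a c k x) has_integral v) {-1..y} \<and> (\<lambda>l. M l (arccos y)) \<longlonglongrightarrow> v"
  proof (rule density_limit[where Sing = Sing and h = h and C = C])
    fix x :: real assume x: "-1 < x" "x < 1" "arccos x \<notin> Sing"
    hence "arccos x \<in> {0..pi}" by (simp add: arccos_lbound arccos_ubound)
    hence "sin (real k * arccos x) \<noteq> 0" "cos (real k * arccos x) \<noteq> 0" using x by (auto simp: Sing_def)
    thus "K * dens_integrand a c k x = h (arccos x) / sqrt (1 - x\<^sup>2)"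
      unfolding K_def h_def using x assms by (intro dens_integrand_eq)
  qed (fact finite_Sing C M_local M_pi y)+
  then obtain v where v: "((\<lambda>x. K * dens_integrand a c k x) has_integral v) {-1..y}"
    "(\<lambda>l. M l (arccos y)) \<longlonglongrightarrow> v" by blast
  have "(dens_integrand a c k has_integral v / K) {-1..y}"
    using has_integral_mult_right[OF v(1), of "1 / K"] K by simp
  hence "(LBINT x:{-1..y}. dens_integrand a c k x) = v / K"
    using y by (intro set_lebesgue_integral_nonneg_eq_integral dens_integrand_nonneg) auto
  hence "K * (LBINT x:{-1..y}. dens_integrand a c k x) = v" using K by simp
  with count_tendsto[OF y v(2)] show
    "(\<lambda>l. real (sieved_zero_count (\<alpha> ((l - 1) div k)) (\<gamma> ((l - 1) div k)) k l y) / real l)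
      \<longlonglongrightarrow> (2 * a + c + 2) / (2 * pi) *
        (LBINT x:{-1..y}.
           sqrt (4 * mu_lim a c - ((poly (cheb_T k) x)\<^sup>2 - kappa_lim a c)\<^sup>2)
           / (\<bar>poly (cheb_U (k - 1)) x\<bar> * \<bar>poly (cheb_T k) x\<bar> * (1 - x\<^sup>2))
           * indicator (closure (E_set k (kappa_lim a c) (mu_lim a c))) x)"
    by (simp only: m_def K_def dens_integrand_def)
qed

end
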